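(* Let $n\ge 3$ and let $\mathcal{D}\subset\mathbb{C}^n$ be the set of $\mathbf{a}\in\mathbb{C}^n$ for which the induced extended Hurwitz map $\phi=\phi_{\mathbf{a}}:\mathcal{A}\to\mathbb{C}$ satisfies: (i) $\phi(\gamma)\notin[-2,2]$ for all $\gamma\in\mathcal{A}$; (ii) the set $\mathcal{A}_\phi(K)=\{\gamma\in\mathcal{A}: |\phi(\gamma)|\le K\}$ is finite for some $K>2$. Then $\mathcal{D}$ is a non-empty open subset of $\mathbb{C}^n$ invariant under $\Gamma_n$, and $\Gamma_n$ acts properly discontinuously on $\mathcal{D}$. Furthermore, $\mathbf{0}\in\mathbb{C}^n$ does not lie in the closure of $\mathcal{D}$.
   Context: $\Gamma_n=\langle b_1,\dots,b_n\mid b_i^2=\mathrm{Id}\rangle$ (free product of $n$ copies of $\mathbb{Z}/2$) acts on $\mathbb{C}^n$ by $b_i(x_1,\dots,x_n)=(x_1,\dots,x_{i-1},\prod_{j\ne i}x_j-x_i,x_{i+1},\dots,x_n)$. $\Delta$ is the Cayley graph of $\Gamma_n$: its vertex set is $V(\Delta)=\Gamma_n$, and $g,h$ are joined by an edge labeled $i$ iff $g=hb_i$; it is an $n$-regular tree. For $1\le i<j\le n$, $\mathcal{A}_{ij}$ is the set of bi-infinite geodesics in $\Delta$ whose edges are alternately labeled $i$ and $j$, and $\mathcal{A}=\bigsqcup_{i<j}\mathcal{A}_{ij}$ is the set of alternating geodesics. For $\mathbf{a}\in\mathbb{C}^n$ let $\Phi_{\mathbf{a}}:V(\Delta)\to\mathbb{C}^n$,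 $\Phi_{\mathbf{a}}(g)=g^{-1}(\mathbf{a})$. The extended Hurwitz map $\phi_{\mathbf{a}}:\mathcal{A}\to\mathbb{C}$ is defined, for $\gamma\in\mathcal{A}_{ij}$ and any vertex $g$ of $\gamma$ with $\Phi_{\mathbf{a}}(g)=(x_1,\dots,x_n)$, by $\phi_{\mathbf{a}}(\gamma)=\prod_{k\ne i,j}x_k$ (this does not depend on the choice of $g$). The action of $\Gamma_n$ on $\mathcal{D}$ is properly discontinuous if for every compact $\mathcal{K}\subset\mathcal{D}$ the set $\{g\in\Gamma_n: g\mathcal{K}\cap\mathcal{K}\ne\emptyset\}$ is finite. *)

theory Defs
  imports "HOL-Analysis.Analysis" "HOL-Algebra.Group_Action"
begin

section \<open>The group\<close>

text \<open>Two words in the letters \<open>b\<^sub>i\<close> (represented by their indices) are related iff they are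
  equal modulo the congruence generated by \<open>b\<^sub>i b\<^sub>i = Id\<close>. Since every \<open>b\<^sub>i\<close> is its own inverse,
  no formal inverse letters are needed. The index set is a finite type \<open>'n\<close>, with \<open>n = CARD('n)\<close>.\<close>

inductive word_rel :: "'n list \<Rightarrow> 'n list \<Rightarrow> bool" where
  word_rel_cancel: "word_rel (u @ [i, i] @ v) (u @ v)"
| word_rel_refl: "word_rel u u"
| word_rel_sym: "word_rel u v \<Longrightarrow> word_rel v u"
| word_rel_trans: "word_rel u v \<Longrightarrow> word_rel v w \<Longrightarrow> word_rel u w"

lemma equivp_word_rel: "equivp word_rel"
  by (intro equivpI reflpI sympI transpI) (blast intro: word_rel.intros)+

quotient_type 'n hurwitz_elem = "'n list" / word_rel
  by (rule equivp_word_rel)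

lemma word_rel_append1: "word_rel u u' \<Longrightarrow> word_rel (u @ w) (u' @ w)"
proof (induction rule: word_rel.induct)
  case (word_rel_cancel u i v)
  then show ?case using word_rel.word_rel_cancel[of u i "v @ w"] by simp
qed (blast intro: word_rel.intros)+

lemma word_rel_append2: "word_rel u u' \<Longrightarrow> word_rel (w @ u) (w @ u')"
proof (induction rule: word_rel.induct)
  case (word_rel_cancel u i v)
  then show ?case using word_rel.word_rel_cancel[of "w @ u" i v] by simp
qed (blast intro: word_rel.intros)+

lift_definition hurwitz_mult :: "'n hurwitz_elem \<Rightarrow> 'n hurwitz_elem \<Rightarrow> 'n hurwitz_elem"
  is "(@)"
  by (meson word_rel_trans word_rel_append1 word_rel_append2)

lift_definition hurwitz_one :: "'n hurwitz_elem" is "[]" .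

lift_definition hurwitz_gen :: "'n \<Rightarrow> 'n hurwitz_elem" is "\<lambda>i. [i]" .

definition hurwitz_group :: "'n hurwitz_elem monoid" where
  "hurwitz_group = \<lparr>carrier = UNIV, mult = hurwitz_mult, one = hurwitz_one\<rparr>"

lemma carrier_hurwitz_group [simp]: "carrier hurwitz_group = UNIV"
  and mult_hurwitz_group [simp]: "mult hurwitz_group = hurwitz_mult"
  and one_hurwitz_group [simp]: "one hurwitz_group = hurwitz_one"
  by (simp_all add: hurwitz_group_def)

lemma word_rel_rev: "word_rel (rev u @ u) []"
proof (induction u)
  case (Cons i u)
  show ?case
    using word_rel_cancel[of "rev u" i u] Cons by (auto intro: word_rel_trans)
qed (simp add: word_rel_refl)

lemma group_hurwitz_group: "group hurwitz_group"
proof (rule groupI, goal_cases)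
  case (3 x y z)
  show ?case by simp (transfer, simp add: word_rel_refl)
next
  case (4 x)
  show ?case by simp (transfer, simp add: word_rel_refl)
next
  case (5 x)
  show ?case by simp (transfer, blast intro: word_rel_rev)
qed simp_all

lemma hurwitz_gen_squared: "hurwitz_mult (hurwitz_gen i) (hurwitz_gen i) = hurwitz_one"
  by transfer (use word_rel_cancel[of "[]"] in simp)

section \<open>The action\<close>

definition hurwitz_b :: "'n::finite \<Rightarrow> complex ^ 'n \<Rightarrow> complex ^ 'n" where
  "hurwitz_b i x = (\<chi> k. if k = i then (\<Prod>j\<in>UNIV - {i}. x $ j) - x $ i else x $ k)"

lemma hurwitz_b_nth:
  "hurwitz_b i x $ k = (if k = i then (\<Prod>j\<in>UNIV - {i}. x $ j) - x $ i else x $ k)"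
  by (simp add: hurwitz_b_def)

lemma hurwitz_b_involution: "hurwitz_b i (hurwitz_b i x) = x"
  by (simp add: vec_eq_iff hurwitz_b_nth)

lift_definition hurwitz_act :: "'n::finite hurwitz_elem \<Rightarrow> complex ^ 'n \<Rightarrow> complex ^ 'n"
  is "foldr hurwitz_b"
proof -
  fix u v :: "'n list"
  show "word_rel u v \<Longrightarrow> foldr hurwitz_b u = foldr hurwitz_b v"
    by (induction rule: word_rel.induct) (auto simp: fun_eq_iff hurwitz_b_involution)
qed

lemma hurwitz_act_gen: "hurwitz_act (hurwitz_gen i) = hurwitz_b i"
  by transfer (simp add: fun_eq_iff)

lemma hurwitz_act_one: "hurwitz_act hurwitz_one = id"
  by transfer (simp add: fun_eq_iff)

lemma hurwitz_act_mult: "hurwitz_act (hurwitz_mult g h) = hurwitz_act g \<circ> hurwitz_act h"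
  by transfer (simp add: fun_eq_iff)

lemma group_action_hurwitz: "group_action hurwitz_group UNIV hurwitz_act"
proof -
  interpret group hurwitz_group by (rule group_hurwitz_group)
  have bij: "bij (hurwitz_act g)" for g :: "'n::finite hurwitz_elem"
  proof (rule o_bij)
    show "hurwitz_act (inv\<^bsub>hurwitz_group\<^esub> g) \<circ> hurwitz_act g = id"
      using l_inv[of g] by (simp flip: hurwitz_act_mult hurwitz_act_one)
    show "hurwitz_act g \<circ> hurwitz_act (inv\<^bsub>hurwitz_group\<^esub> g) = id"
      using r_inv[of g] by (simp flip: hurwitz_act_mult hurwitz_act_one)
  qed
  show ?thesis
    unfolding group_action_def
    by (intro group_hom.intro group_hom_axioms.intro group_BijGroup homI group_hurwitz_group)
      (auto simp: BijGroup_def Bij_def bij hurwitz_act_mult fun_eq_iff compose_def)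
qed

definition properly_discontinuous_on ::
    "('g, 'm) monoid_scheme \<Rightarrow> ('g \<Rightarrow> 'a::topological_space \<Rightarrow> 'a) \<Rightarrow> 'a set \<Rightarrow> bool" where
  "properly_discontinuous_on G act D \<longleftrightarrow>
     (\<forall>K. compact K \<and> K \<subseteq> D \<longrightarrow> finite {g \<in> carrier G. act g ` K \<inter> K \<noteq> {}})"

section \<open>The Cayley graph and alternating geodesics\<close>

definition cayley_edge :: "'n \<Rightarrow> 'n hurwitz_elem \<Rightarrow> 'n hurwitz_elem \<Rightarrow> bool" where
  "cayley_edge i g h \<longleftrightarrow> g = h \<otimes>\<^bsub>hurwitz_group\<^esub> hurwitz_gen i"

definition cayley_adj :: "'n hurwitz_elem \<Rightarrow> 'n hurwitz_elem \<Rightarrow> bool" where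
  "cayley_adj g h \<longleftrightarrow> (\<exists>i. cayley_edge i g h)"

definition cayley_dist :: "'n hurwitz_elem \<Rightarrow> 'n hurwitz_elem \<Rightarrow> nat" where
  "cayley_dist g h = (LEAST k. (cayley_adj ^^ k) g h)"

definition biinfinite_geodesic :: "(int \<Rightarrow> 'n hurwitz_elem) \<Rightarrow> bool" where
  "biinfinite_geodesic p \<longleftrightarrow> (\<forall>m n. cayley_dist (p m) (p n) = nat \<bar>m - n\<bar>)"

text \<open>Geodesics are unparametrised: a geodesic is identified with its set of vertices, which
  determines it as a subgraph because the Cayley graph is a tree. Shifting the parametrisation by
  one exchanges the roles of \<open>i\<close> and \<open>j\<close>, so this set depends only on the unordered pair
  \<open>{i, j}\<close>, and \<open>i < j\<close> may be replaced by \<open>i \<noteq> j\<close>.\<close>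

definition alt_geodesics_ij :: "'n \<Rightarrow> 'n \<Rightarrow> 'n hurwitz_elem set set" where
  "alt_geodesics_ij i j = {range p |p. biinfinite_geodesic p \<and>
     (\<forall>m. cayley_edge (if even m then i else j) (p m) (p (m + 1)))}"

definition alt_geodesics :: "'n hurwitz_elem set set" where
  "alt_geodesics = (\<Union>i. \<Union>j\<in>UNIV - {i}. alt_geodesics_ij i j)"

section \<open>The extended Hurwitz map\<close>

definition hurwitz_Phi :: "complex ^ 'n \<Rightarrow> 'n::finite hurwitz_elem \<Rightarrow> complex ^ 'n" where
  "hurwitz_Phi a g = hurwitz_act (inv\<^bsub>hurwitz_group\<^esub> g) a"

text \<open>The description is unique by \<open>hurwitz_map_eq\<close> below.\<close>

definition hurwitz_map :: "complex ^ 'n \<Rightarrow> 'n::finite hurwitz_elem set \<Rightarrow> complex" where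
  "hurwitz_map a \<gamma> = (THE z. \<exists>i j g. i \<noteq> j \<and> \<gamma> \<in> alt_geodesics_ij i j \<and> g \<in> \<gamma> \<and>
     z = (\<Prod>k\<in>UNIV - {i, j}. hurwitz_Phi a g $ k))"

lemma inj_hurwitz_gen: "hurwitz_gen i = hurwitz_gen j \<Longrightarrow> i = j"
proof transfer
  fix i j :: 'n
  have "word_rel u v \<Longrightarrow> even (count_list u i) = even (count_list v i)" for u v
    by (induction rule: word_rel.induct) auto
  from this[of "[i]" "[j]"] show "word_rel [i] [j] \<Longrightarrow> i = j"
    by (auto split: if_splits)
qed

lemma cayley_edge_sym: "cayley_edge i g h \<longleftrightarrow> cayley_edge i h g"
proof -
  interpret group hurwitz_group by (rule group_hurwitz_group)
  have "h = g \<otimes>\<^bsub>hurwitz_group\<^esub> hurwitz_gen i"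
    if "g = h \<otimes>\<^bsub>hurwitz_group\<^esub> hurwitz_gen i" for g h :: "'a hurwitz_elem"
    using that m_assoc[of h "hurwitz_gen i" "hurwitz_gen i"] r_one[of h]
    by (simp add: hurwitz_gen_squared)
  then show ?thesis unfolding cayley_edge_def by blast
qed

lemma cayley_edge_label_unique:
  assumes "cayley_edge i g h" "cayley_edge j g h"
  shows "i = j"
proof -
  interpret group hurwitz_group by (rule group_hurwitz_group)
  have "hurwitz_gen i = hurwitz_gen j"
    using assms Units_l_cancel[of h "hurwitz_gen i" "hurwitz_gen j"] by (simp add: cayley_edge_def)
  then show ?thesis by (rule inj_hurwitz_gen)
qed

lemma hurwitz_Phi_edge:
  assumes "cayley_edge i g h"
  shows "hurwitz_Phi a g = hurwitz_b i (hurwitz_Phi a h)"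
proof -
  interpret group hurwitz_group by (rule group_hurwitz_group)
  have "inv\<^bsub>hurwitz_group\<^esub> hurwitz_gen i = hurwitz_gen i"
    by (rule inv_equality) (simp_all add: hurwitz_gen_squared)
  then have "inv\<^bsub>hurwitz_group\<^esub> g = hurwitz_mult (hurwitz_gen i) (inv\<^bsub>hurwitz_group\<^esub> h)"
    using assms inv_mult_group[of h "hurwitz_gen i"] by (simp add: cayley_edge_def)
  then show ?thesis
    by (simp add: hurwitz_Phi_def hurwitz_act_mult hurwitz_act_gen)
qed

lemma alt_geodesics_ij_subset:
  assumes "\<gamma> \<in> alt_geodesics_ij i j" "\<gamma> \<in> alt_geodesics_ij i' j'"
  shows "{i, j} \<subseteq> {i', j'}"
proof -
  obtain p where p: "\<gamma> = range p" "biinfinite_geodesic p"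
      "\<And>m. cayley_edge (if even m then i else j) (p m) (p (m + 1))"
    using assms(1) by (auto simp: alt_geodesics_ij_def)
  obtain q where q: "\<gamma> = range q" "biinfinite_geodesic q"
      "\<And>m. cayley_edge (if even m then i' else j') (q m) (q (m + 1))"
    using assms(2) by (auto simp: alt_geodesics_ij_def)
  have *: "l \<in> {i', j'}" if l: "cayley_edge l (p m) (p (m + 1))" for l m
  proof -
    obtain a b where ab: "p m = q a" "p (m + 1) = q b"
      using p(1) q(1) by (metis image_iff rangeI)
    have "nat \<bar>a - b\<bar> = cayley_dist (p m) (p (m + 1))"
      using q(2) ab by (simp add: biinfinite_geodesic_def)
    also have "\<dots> = 1"
      using p(2) by (simp add: biinfinite_geodesic_def)
    finally have "b = a + 1 \<or> a = b + 1" by linarith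
    then have "cayley_edge (if even a then i' else j') (p m) (p (m + 1)) \<or>
        cayley_edge (if even b then i' else j') (p m) (p (m + 1))"
    proof
      assume "b = a + 1"
      then show ?thesis using q(3)[of a] ab by simp
    next
      assume "a = b + 1"
      then show ?thesis using q(3)[of b] ab by (simp add: cayley_edge_sym[of _ "q (b + 1)"])
    qed
    then have "l = (if even a then i' else j') \<or> l = (if even b then i' else j')"
      using cayley_edge_label_unique[OF l] by blast
    then show ?thesis by (auto split: if_splits)
  qed
  show ?thesis
    using *[of i 0] *[of j 1] p(3)[of 0] p(3)[of 1] by auto
qed

lemma hurwitz_map_eq:
  assumes "i \<noteq> j" "\<gamma> \<in> alt_geodesics_ij i j" "g \<in> \<gamma>"
  shows "hurwitz_map a \<gamma> = (\<Prod>k\<in>UNIV - {i, j}. hurwitz_Phi a g $ k)"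
proof -
  let ?F = "\<lambda>g. \<Prod>k\<in>UNIV - {i, j}. hurwitz_Phi a g $ k"
  obtain p where p': "\<gamma> = range p" "biinfinite_geodesic p"
      "\<And>m. cayley_edge (if even m then i else j) (p m) (p (m + 1))"
    using assms(2) by (auto simp: alt_geodesics_ij_def)
  note p = p'(1,3)
  have step: "?F (p m) = ?F (p (m + 1))" for m
    unfolding hurwitz_Phi_edge[OF p(2)[of m]]
    by (rule prod.cong) (auto simp: hurwitz_b_nth)
  have const: "?F (p m) = ?F (p 0)" for m
  proof (induction m rule: int_induct[where k = 0])
    case base
    show ?case by (rule refl)
  next
    case (step1 m)
    then show ?case by (simp only: step[of m, symmetric])
  next
    case (step2 m)
    have "?F (p (m - 1)) = ?F (p m)" using step[of "m - 1"] by (simp only: diff_add_cancel)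
    then show ?case using step2(2) by (rule trans)
  qed
  show ?thesis
    unfolding hurwitz_map_def
  proof (rule the_equality)
    show "\<exists>i' j' g'. i' \<noteq> j' \<and> \<gamma> \<in> alt_geodesics_ij i' j' \<and> g' \<in> \<gamma> \<and>
        ?F g = (\<Prod>k\<in>UNIV - {i', j'}. hurwitz_Phi a g' $ k)"
      by (intro exI[of _ i] exI[of _ j] exI[of _ g] conjI assms refl)
  next
    fix z
    assume "\<exists>i' j' g'. i' \<noteq> j' \<and> \<gamma> \<in> alt_geodesics_ij i' j' \<and> g' \<in> \<gamma> \<and>
        z = (\<Prod>k\<in>UNIV - {i', j'}. hurwitz_Phi a g' $ k)"
    then obtain i' j' g' where *: "\<gamma> \<in> alt_geodesics_ij i' j'" "g' \<in> \<gamma>"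
        "z = (\<Prod>k\<in>UNIV - {i', j'}. hurwitz_Phi a g' $ k)" by blast
    have "{i', j'} = {i, j}"
      using alt_geodesics_ij_subset[OF *(1) assms(2)] alt_geodesics_ij_subset[OF assms(2) *(1)]
      by (rule subset_antisym)
    then have z: "z = ?F g'" using *(3) by (simp only:)
    obtain m m' where "g' = p m" "g = p m'" using *(2) assms(3) p(1) by blast
    then have "?F g' = ?F g" using const[of m] const[of m'] by (simp only:)
    with z show "z = ?F g" by (rule trans)
  qed
qed

end

theory Submission
  imports Defs "HOL-Complex_Analysis.Conformal_Mappings"
begin

text \<open>
  The alternating geodesics are the cosets \<open>g \<langle>b\<^sub>i, b\<^sub>j\<rangle>\<close>. Fix \<open>R \<ge> 2\<close> and call an edge of the tree good if
  the coordinate changed by it grows and the values of \<open>\<phi>\<close> it introduces exceed \<open>R\<close>, in a form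
  that is open in the base point and passes to all later edges of a reduced path. For a point of
  the domain every infinite ray contains a good edge: a ray ending in an alternating geodesic is
  governed by a linear recurrence whose solution cannot decay, by (ii); on any other ray all
  values of \<open>\<phi>\<close> eventually exceed some \<open>K > 2\<close>, so coordinates cannot decrease forever, and once
  one increases all values of \<open>\<phi>\<close> tend to infinity. By Koenig's lemma all edges at some finite
  depth are good, and stay so near the point. Hence, locally uniformly in the base point, only
  finitely many geodesics satisfy \<open>\<bar>\<phi>\<bar> \<le> R\<close>, which gives openness and proper discontinuity.

  At the origin, which \<open>\<Gamma>\<^sub>n\<close> fixes, the elements \<open>(b\<^sub>i b\<^sub>j)\<^sup>2\<close> are tangent to the identity. As in the
  Zassenhaus lemma, their iterated commutators converge to the identity on a fixed neighbourhood
  of \<open>0\<close>, so every point there has infinitely many bounded translates, which (ii) forbids.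
\<close>

section \<open>Reduced words\<close>

definition word_elem :: "'n list \<Rightarrow> 'n hurwitz_elem" where
  "word_elem = abs_hurwitz_elem"

lemma word_elem_eq_iff: "word_elem u = word_elem v \<longleftrightarrow> word_rel u v"
  unfolding word_elem_def by (rule hurwitz_elem.abs_eq_iff)

lemma word_elem_append: "word_elem (u @ v) = hurwitz_mult (word_elem u) (word_elem v)"
  unfolding word_elem_def by (simp add: hurwitz_mult.abs_eq)

lemma word_elem_Nil: "word_elem [] = hurwitz_one"
  unfolding word_elem_def by (simp add: hurwitz_one_def)

lemma word_elem_single: "word_elem [i] = hurwitz_gen i"
  unfolding word_elem_def by (simp add: hurwitz_gen.abs_eq)

lemma hurwitz_mult_assoc: "hurwitz_mult (hurwitz_mult g h) k = hurwitz_mult g (hurwitz_mult h k)"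
  using monoid.m_assoc[OF group.is_monoid[OF group_hurwitz_group], of g h k] by simp

lemma hurwitz_one_left [simp]: "hurwitz_mult hurwitz_one g = g"
  using monoid.l_one[OF group.is_monoid[OF group_hurwitz_group], of g] by simp

lemma hurwitz_one_right [simp]: "hurwitz_mult g hurwitz_one = g"
  using monoid.r_one[OF group.is_monoid[OF group_hurwitz_group], of g] by simp

lemma hurwitz_mult_left_cancel: "hurwitz_mult g h = hurwitz_mult g k \<longleftrightarrow> h = k"
  using group.Units_eq[OF group_hurwitz_group]
    monoid.Units_l_cancel[OF group.is_monoid[OF group_hurwitz_group], of g h k] by auto

lemma inv_word_elem: "inv\<^bsub>hurwitz_group\<^esub> (word_elem w) = word_elem (rev w)"
proof (rule group.inv_equality[OF group_hurwitz_group])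
  show "word_elem (rev w) \<otimes>\<^bsub>hurwitz_group\<^esub> word_elem w = \<one>\<^bsub>hurwitz_group\<^esub>"
    by (simp flip: word_elem_append word_elem_Nil add: word_elem_eq_iff word_rel_rev)
qed simp_all

text \<open>Left multiplication by a generator, carried out on normal forms: on reduced words
  (\<open>distinct_adj\<close>) it is an involution.\<close>

definition push :: "'n \<Rightarrow> 'n list \<Rightarrow> 'n list" where
  "push i w = (if w \<noteq> [] \<and> hd w = i then tl w else i # w)"

definition reduce :: "'n list \<Rightarrow> 'n list" where
  "reduce w = foldr push w []"

lemma push_push:
  assumes "distinct_adj w"
  shows "push i (push i w) = w"
  using assms by (cases w) (auto simp: push_def distinct_adj_Cons)

lemma distinct_adj_push: "distinct_adj w \<Longrightarrow> distinct_adj (push i w)"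
  by (cases w) (auto simp: push_def distinct_adj_Cons)

lemma distinct_adj_foldr_push: "distinct_adj v \<Longrightarrow> distinct_adj (foldr push w v)"
  by (induction w) (auto intro: distinct_adj_push)

lemma distinct_adj_reduce: "distinct_adj (reduce w)"
  unfolding reduce_def by (rule distinct_adj_foldr_push) simp

text \<open>Van der Waerden's trick: the letters act on reduced words by involutions, so this action
  respects the defining relations. Applied to the empty word, it shows that reduced words are unique
  normal forms.\<close>

lemma foldr_push_cong:
  "word_rel u v \<Longrightarrow> distinct_adj w \<Longrightarrow> foldr push u w = foldr push v w"
  by (induction arbitrary: w rule: word_rel.induct) (auto simp: push_push distinct_adj_foldr_push)

lemma reduce_cong: "word_rel u v \<Longrightarrow> reduce u = reduce v"
  unfolding reduce_def by (rule foldr_push_cong) simp_all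

lemma push_rel: "word_rel (push i w) (i # w)"
proof (cases "w \<noteq> [] \<and> hd w = i")
  case True
  then obtain v where "w = i # v" by (cases w) auto
  then show ?thesis
    using word_rel_cancel[of "[]" i v] by (simp add: push_def word_rel_sym)
next
  case False
  then have "push i w = i # w" by (auto simp: push_def)
  then show ?thesis by (simp add: word_rel_refl)
qed

lemma reduce_rel: "word_rel (reduce w) w"
proof (induction w)
  case (Cons i w)
  have "word_rel (push i (reduce w)) (i # reduce w)" by (rule push_rel)
  moreover have "word_rel (i # reduce w) (i # w)"
    using word_rel_append2[OF Cons, of "[i]"] by simp
  ultimately show ?case
    unfolding reduce_def by (simp add: word_rel_trans)
qed (simp add: reduce_def word_rel_refl)

lemma reduce_distinct_adj: "distinct_adj w \<Longrightarrow> reduce w = w"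
  by (induction w) (auto simp: reduce_def push_def distinct_adj_Cons)

lemma set_reduce: "set (reduce w) \<subseteq> set w"
  by (induction w) (auto simp: reduce_def push_def dest: list.set_sel(2))

lemma length_reduce: "length (reduce w) \<le> length w"
  by (induction w) (auto simp: reduce_def push_def)

lemma word_elem_reduce: "word_elem (reduce w) = word_elem w"
  by (simp add: word_elem_eq_iff reduce_rel)

lemma word_elem_eq_iff_reduce: "word_elem u = word_elem v \<longleftrightarrow> reduce u = reduce v"
  using reduce_cong word_elem_eq_iff word_elem_reduce by metis

lemma word_elem_inj:
  "distinct_adj u \<Longrightarrow> distinct_adj v \<Longrightarrow> word_elem u = word_elem v \<longleftrightarrow> u = v"
  by (simp add: word_elem_eq_iff_reduce reduce_distinct_adj)

lemma hurwitz_elem_cases: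
  obtains w where "distinct_adj w" "g = word_elem w"
proof -
  obtain v where "g = word_elem v"
    unfolding word_elem_def by (induction g rule: hurwitz_elem.abs_induct) auto
  then show ?thesis
    using that[of "reduce v"] by (simp add: word_elem_reduce distinct_adj_reduce)
qed

section \<open>Alternating geodesics as cosets of dihedral subgroups\<close>

definition dihedral_coset :: "'n hurwitz_elem \<Rightarrow> 'n \<Rightarrow> 'n \<Rightarrow> 'n hurwitz_elem set" where
  "dihedral_coset g i j = {hurwitz_mult g (word_elem w) |w. set w \<subseteq> {i, j}}"

lemma dihedral_coset_self: "g \<in> dihedral_coset g i j"
  unfolding dihedral_coset_def by (auto intro!: exI[of _ "[]"] simp: word_elem_Nil)

lemma dihedral_coset_mult:
  assumes "set w \<subseteq> {i, j}"
  shows "dihedral_coset (hurwitz_mult g (word_elem w)) i j = dihedral_coset g i j"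
proof
  show "dihedral_coset (hurwitz_mult g (word_elem w)) i j \<subseteq> dihedral_coset g i j"
  proof
    fix x assume "x \<in> dihedral_coset (hurwitz_mult g (word_elem w)) i j"
    then obtain v where "set v \<subseteq> {i, j}" "x = hurwitz_mult (hurwitz_mult g (word_elem w)) (word_elem v)"
      by (auto simp: dihedral_coset_def)
    then have "set (w @ v) \<subseteq> {i, j}" "x = hurwitz_mult g (word_elem (w @ v))"
      using assms by (auto simp: word_elem_append hurwitz_mult_assoc)
    then show "x \<in> dihedral_coset g i j" unfolding dihedral_coset_def by blast
  qed
  show "dihedral_coset g i j \<subseteq> dihedral_coset (hurwitz_mult g (word_elem w)) i j"
  proof
    fix x assume "x \<in> dihedral_coset g i j"
    then obtain v where v: "set v \<subseteq> {i, j}" "x = hurwitz_mult g (word_elem v)"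
      by (auto simp: dihedral_coset_def)
    have "word_elem (w @ rev w) = hurwitz_one"
      using word_rel_rev[of "rev w"] by (simp flip: word_elem_Nil add: word_elem_eq_iff)
    then have "hurwitz_mult (hurwitz_mult g (word_elem w)) (word_elem (rev w @ v)) = x"
      by (simp add: v(2) word_elem_append hurwitz_mult_assoc) (simp flip: hurwitz_mult_assoc)
    moreover have "set (rev w @ v) \<subseteq> {i, j}" using assms v(1) by auto
    ultimately show "x \<in> dihedral_coset (hurwitz_mult g (word_elem w)) i j"
      unfolding dihedral_coset_def by blast
  qed
qed

text \<open>Reduction introduces no new letters, so the normal form of a word in \<open>i\<close>
  and \<open>j\<close> still uses only these two.\<close>

lemma dihedral_coset_eqD:
  assumes "dihedral_coset g i j = dihedral_coset (hurwitz_mult g (word_elem w)) i j" "distinct_adj w"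
  shows "set w \<subseteq> {i, j}"
proof -
  have "hurwitz_mult g (word_elem w) \<in> dihedral_coset g i j"
    using assms(1) dihedral_coset_self by metis
  then obtain v where v: "set v \<subseteq> {i, j}" "word_elem w = word_elem v"
    by (auto simp: dihedral_coset_def hurwitz_mult_left_cancel)
  then have "w = reduce v" using assms(2) by (simp add: word_elem_eq_iff_reduce reduce_distinct_adj)
  then show ?thesis using set_reduce[of v] v(1) by auto
qed

lemma dihedral_coset_left_mult:
  "hurwitz_mult h ` dihedral_coset g i j = dihedral_coset (hurwitz_mult h g) i j"
  unfolding dihedral_coset_def by (auto simp: hurwitz_mult_assoc image_iff)

text \<open>Stripping trailing letters \<open>i\<close> and \<open>j\<close> leads to the vertex of
  the coset nearest to the identity. The last letter of \<open>u\<close>, if any, labels the edge by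
  which the path from the identity reaches the geodesic.\<close>

lemma dihedral_coset_gate:
  obtains u where "distinct_adj u" "dihedral_coset g i j = dihedral_coset (word_elem u) i j"
    "u = [] \<or> last u \<notin> {i, j}"
proof -
  have "\<exists>v. distinct_adj v \<and> dihedral_coset (word_elem u) i j = dihedral_coset (word_elem v) i j \<and>
      (v = [] \<or> last v \<notin> {i, j})" if "distinct_adj u" for u
    using that
  proof (induction u rule: rev_induct)
    case (snoc l u)
    show ?case
    proof (cases "l \<in> {i, j}")
      case True
      then have "dihedral_coset (word_elem (u @ [l])) i j = dihedral_coset (word_elem u) i j"
        unfolding word_elem_append by (intro dihedral_coset_mult) auto
      then show ?thesis using snoc by auto
    next
      case False
      then show ?thesis using snoc.prems by (intro exI[of _ "u @ [l]"]) auto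
    qed
  qed (auto intro!: exI[of _ "[]"])
  then show ?thesis using that by (metis hurwitz_elem_cases)
qed

text \<open>A vertex is the only common point of three of the geodesics through it.\<close>

lemma finite_vertices_of_cosets:
  fixes S :: "'n::finite hurwitz_elem set"
  assumes n: "CARD('n) \<ge> 3" and F: "finite F"
    and S: "\<And>g i j. g \<in> S \<Longrightarrow> i \<noteq> j \<Longrightarrow> dihedral_coset g i j \<in> F"
  shows "finite S"
proof -
  obtain T :: "'n set" where "card T = 3" using n obtain_subset_with_card_n by blast
  then obtain a b c :: 'n where abc: "a \<noteq> b" "a \<noteq> c" "b \<noteq> c"
    by (auto simp: card_3_iff)
  let ?f = "\<lambda>g. (dihedral_coset g a b, dihedral_coset g a c, dihedral_coset g b c)"
  have "inj_on ?f S"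
  proof (rule inj_onI)
    fix g h assume "?f g = ?f h"
    moreover obtain w where w: "distinct_adj w"
        "hurwitz_mult (inv\<^bsub>hurwitz_group\<^esub> g) h = word_elem w"
      using hurwitz_elem_cases by metis
    have "hurwitz_mult g (inv\<^bsub>hurwitz_group\<^esub> g) = hurwitz_one"
      using group.r_inv[OF group_hurwitz_group, of g] by simp
    then have h: "h = hurwitz_mult g (word_elem w)"
      unfolding w(2)[symmetric] by (metis hurwitz_mult_assoc hurwitz_one_left)
    ultimately have "set w \<subseteq> {a, b}" "set w \<subseteq> {a, c}" "set w \<subseteq> {b, c}"
      by (auto intro!: dihedral_coset_eqD[OF _ w(1)])
    then have "set w \<subseteq> {a, b} \<inter> {a, c} \<inter> {b, c}" by (intro Int_greatest)
    also have "\<dots> \<subseteq> {}" using abc by (simp add: Int_insert_left Int_insert_right)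
    finally have "w = []" by simp
    then show "g = h" using h by (simp add: word_elem_Nil)
  qed
  moreover have "?f ` S \<subseteq> F \<times> F \<times> F" using S abc by auto
  ultimately show ?thesis using F by (meson finite_SigmaI finite_subset finite_imageD)
qed

section \<open>Distances and alternating paths in the Cayley graph\<close>

lemma cayley_edge_iff: "cayley_edge l g h \<longleftrightarrow> h = hurwitz_mult g (word_elem [l])"
  by (subst cayley_edge_sym) (simp add: cayley_edge_def word_elem_single)

lemma cayley_path_iff:
  "(cayley_adj ^^ k) g h \<longleftrightarrow> (\<exists>w. length w = k \<and> h = hurwitz_mult g (word_elem w))"
proof (induction k arbitrary: h)
  case 0
  show ?case by (auto simp: word_elem_Nil)
next
  case (Suc k)
  show ?case
  proof
    assume "(cayley_adj ^^ Suc k) g h"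
    then obtain h' where "(cayley_adj ^^ k) g h'" "cayley_adj h' h" by auto
    then obtain w l where "length w = k" "h' = hurwitz_mult g (word_elem w)"
        "h = hurwitz_mult h' (word_elem [l])"
      using Suc by (auto simp: cayley_adj_def cayley_edge_iff)
    then show "\<exists>w. length w = Suc k \<and> h = hurwitz_mult g (word_elem w)"
      by (intro exI[of _ "w @ [l]"]) (simp add: word_elem_append hurwitz_mult_assoc)
  next
    assume "\<exists>w. length w = Suc k \<and> h = hurwitz_mult g (word_elem w)"
    then obtain w where "length w = Suc k" "h = hurwitz_mult g (word_elem w)" by blast
    then obtain v l where vl: "w = v @ [l]" "length v = k" by (metis length_Suc_conv_rev)
    then have "(cayley_adj ^^ k) g (hurwitz_mult g (word_elem v))" using Suc by blast
    moreover have "cayley_adj (hurwitz_mult g (word_elem v)) h"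
      using vl \<open>h = _\<close>
      by (auto simp: cayley_adj_def cayley_edge_iff word_elem_append hurwitz_mult_assoc)
    ultimately show "(cayley_adj ^^ Suc k) g h" by auto
  qed
qed

text \<open>A walk of length \<open>k\<close> spells a word of length \<open>k\<close>; if it has
  the same endpoints, that word reduces to \<open>w\<close>, and reduction never lengthens a
  word.\<close>

lemma cayley_dist_mult:
  assumes "distinct_adj w"
  shows "cayley_dist g (hurwitz_mult g (word_elem w)) = length w"
  unfolding cayley_dist_def
proof (rule Least_equality)
  show "(cayley_adj ^^ length w) g (hurwitz_mult g (word_elem w))"
    by (auto simp: cayley_path_iff)
next
  fix k assume "(cayley_adj ^^ k) g (hurwitz_mult g (word_elem w))"
  then obtain v where v: "length v = k" "word_elem w = word_elem v"
    by (auto simp: cayley_path_iff hurwitz_mult_left_cancel)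
  then have "w = reduce v" using assms by (simp add: word_elem_eq_iff_reduce reduce_distinct_adj)
  then show "length w \<le> k" using length_reduce[of v] v(1) by simp
qed

lemma cayley_dist_mult':
  assumes "distinct_adj w"
  shows "cayley_dist (hurwitz_mult g (word_elem w)) g = length w"
proof -
  have "word_elem (w @ rev w) = hurwitz_one"
    using word_rel_rev[of "rev w"] by (simp flip: word_elem_Nil add: word_elem_eq_iff)
  then have "g = hurwitz_mult (hurwitz_mult g (word_elem w)) (word_elem (rev w))"
    by (simp add: hurwitz_mult_assoc flip: word_elem_append)
  then show ?thesis
    using cayley_dist_mult[of "rev w" "hurwitz_mult g (word_elem w)"] assms by simp
qed

fun alt_word :: "'n \<Rightarrow> 'n \<Rightarrow> nat \<Rightarrow> 'n list" where
  "alt_word i j 0 = []"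
| "alt_word i j (Suc k) = i # alt_word j i k"

lemma length_alt_word [simp]: "length (alt_word i j k) = k"
  by (induction i j k rule: alt_word.induct) auto

lemma distinct_adj_alt_word: "i \<noteq> j \<Longrightarrow> distinct_adj (alt_word i j k)"
proof (induction i j k rule: alt_word.induct)
  case (2 i j k)
  then show ?case by (cases k) auto
qed auto

lemma alt_word_snoc: "alt_word i j (Suc k) = alt_word i j k @ [if even k then i else j]"
  by (induction i j k rule: alt_word.induct) auto

lemma alternating_path:
  assumes "\<And>m::int. cayley_edge (if even m then i else j) (p m) (p (m + 1))"
  shows "p (m + int k) = hurwitz_mult (p m)
    (word_elem (if even m then alt_word i j k else alt_word j i k))"
proof (induction k)
  case (Suc k)
  have "p (m + int (Suc k)) = hurwitz_mult (p (m + int k))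
      (word_elem [if even (m + int k) then i else j])"
    using assms[of "m + int k"] by (simp add: cayley_edge_iff ac_simps)
  moreover have "(if even m then alt_word i j (Suc k) else alt_word j i (Suc k)) =
      (if even m then alt_word i j k else alt_word j i k) @ [if even (m + int k) then i else j]"
    by (simp add: alt_word_snoc del: alt_word.simps)
  ultimately show ?case
    by (simp only: Suc hurwitz_mult_assoc word_elem_append)
qed (simp add: word_elem_Nil)

lemma alternating_path_geodesic:
  assumes "i \<noteq> j" "\<And>m::int. cayley_edge (if even m then i else j) (p m) (p (m + 1))"
  shows "biinfinite_geodesic p"
proof -
  have d: "distinct_adj (if even m then alt_word i j k else alt_word j i k)" for m :: int and k
    using assms(1) distinct_adj_alt_word[of i j k] distinct_adj_alt_word[of j i k] by simp
  have l: "length (if even m then alt_word i j k else alt_word j i k) = k" for m :: int and k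
    by simp
  have le: "cayley_dist (p m) (p (m + int k)) = k" for m k
    by (simp only: alternating_path[OF assms(2)] cayley_dist_mult[OF d] l)
  have ge: "cayley_dist (p (m + int k)) (p m) = k" for m k
    by (simp only: alternating_path[OF assms(2)] cayley_dist_mult'[OF d] l)
  show ?thesis
    unfolding biinfinite_geodesic_def
  proof (intro allI)
    fix m n :: int
    show "cayley_dist (p m) (p n) = nat \<bar>m - n\<bar>"
      using le[of m "nat (n - m)"] ge[of n "nat (m - n)"] by (cases "m \<le> n") auto
  qed
qed

lemma alternating_path_range:
  assumes p: "\<And>m::int. cayley_edge (if even m then i else j) (p m) (p (m + 1))"
  shows "range p = dihedral_coset (p 0) i j"
proof
  have "p m \<in> dihedral_coset (p 0) i j" for m
  proof (induction m rule: int_induct[where k = 0])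
    case base
    show ?case by (rule dihedral_coset_self)
  next
    case (step1 m)
    then obtain w where w: "set w \<subseteq> {i, j}" "p m = hurwitz_mult (p 0) (word_elem w)"
      by (auto simp: dihedral_coset_def)
    have "p (m + 1) = hurwitz_mult (p 0) (word_elem (w @ [if even m then i else j]))"
      using p[of m] w(2) by (simp add: cayley_edge_iff word_elem_append hurwitz_mult_assoc)
    moreover have "set (w @ [if even m then i else j]) \<subseteq> {i, j}" using w(1) by auto
    ultimately show ?case unfolding dihedral_coset_def by blast
  next
    case (step2 m)
    then obtain w where w: "set w \<subseteq> {i, j}" "p m = hurwitz_mult (p 0) (word_elem w)"
      by (auto simp: dihedral_coset_def)
    have "cayley_edge (if even (m - 1) then i else j) (p m) (p (m - 1))"
      using p[of "m - 1"] by (subst cayley_edge_sym) simp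
    then have "p (m - 1) = hurwitz_mult (p 0) (word_elem (w @ [if even (m - 1) then i else j]))"
      unfolding cayley_edge_iff w(2) by (simp only: word_elem_append hurwitz_mult_assoc)
    moreover have "set (w @ [if even (m - 1) then i else j]) \<subseteq> {i, j}" using w(1) by auto
    ultimately show ?case unfolding dihedral_coset_def by blast
  qed
  then show "range p \<subseteq> dihedral_coset (p 0) i j" by auto
  \<comment> \<open>Both edges at \<open>p m\<close> with labels \<open>i\<close> and
    \<open>j\<close> belong to the path: one leads forward, the other back, so no word in these
    letters leaves it.\<close>
  have step: "\<exists>m'. hurwitz_mult (p m) (word_elem [l]) = p m'" if "l \<in> {i, j}" for m l
  proof (cases "l = (if even m then i else j)")
    case True
    then have "hurwitz_mult (p m) (word_elem [l]) = p (m + 1)"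
      using p[of m] by (simp add: cayley_edge_iff)
    then show ?thesis by blast
  next
    case False
    then have "l = (if even (m - 1) then i else j)" using that by (auto split: if_splits)
    then have "cayley_edge l (p (m - 1)) (p m)" using p[of "m - 1"] by simp
    then have "p (m - 1) = hurwitz_mult (p m) (word_elem [l])"
      by (subst (asm) cayley_edge_sym) (simp add: cayley_edge_iff)
    then show ?thesis by metis
  qed
  have "\<exists>m'. hurwitz_mult (p 0) (word_elem w) = p m'" if "set w \<subseteq> {i, j}" for w
    using that
  proof (induction w rule: rev_induct)
    case Nil
    show ?case by (auto simp: word_elem_Nil)
  next
    case (snoc l w)
    then obtain m where "hurwitz_mult (p 0) (word_elem w) = p m" by auto
    then have "hurwitz_mult (p 0) (word_elem (w @ [l])) = hurwitz_mult (p m) (word_elem [l])"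
      by (simp add: word_elem_append flip: hurwitz_mult_assoc)
    then show ?case using step[of l m] snoc.prems by auto
  qed
  then show "dihedral_coset (p 0) i j \<subseteq> range p" unfolding dihedral_coset_def by blast
qed

lemma alt_geodesics_ij_eq:
  assumes "i \<noteq> j"
  shows "alt_geodesics_ij i j = range (\<lambda>g. dihedral_coset g i j)"
proof
  show "alt_geodesics_ij i j \<subseteq> range (\<lambda>g. dihedral_coset g i j)"
    unfolding alt_geodesics_ij_def using alternating_path_range[of i j] by blast
  show "range (\<lambda>g. dihedral_coset g i j) \<subseteq> alt_geodesics_ij i j"
  proof
    fix \<gamma> assume "\<gamma> \<in> range (\<lambda>g. dihedral_coset g i j)"
    then obtain g where g: "\<gamma> = dihedral_coset g i j" by blast
    \<comment> \<open>Going backwards from \<open>g\<close> the first letter is \<open>j\<close>,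
      since the edge from time -1 to time 0 has odd index.\<close>
    define p where "p = (\<lambda>m::int. hurwitz_mult g (word_elem
      (if m \<ge> 0 then alt_word i j (nat m) else alt_word j i (nat (- m)))))"
    have edge: "cayley_edge (if even m then i else j) (p m) (p (m + 1))" for m
    proof (cases "m \<ge> 0")
      case True
      then have "nat (m + 1) = Suc (nat m)" by simp
      then show ?thesis
        using True by (simp add: p_def cayley_edge_iff hurwitz_mult_assoc alt_word_snoc
            even_nat_iff del: alt_word.simps flip: word_elem_append)
    next
      case False
      define k where "k = nat (- m - 1)"
      have m: "m = - int k - 1" using False by (simp add: k_def)
      have pm: "p m = hurwitz_mult g (word_elem (alt_word j i (Suc k)))"
      proof -
        have "nat (- m) = Suc k" using m by simp
        then show ?thesis using False by (simp add: p_def del: alt_word.simps)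
      qed
      have pm1: "p (m + 1) = hurwitz_mult g (word_elem (alt_word j i k))"
        using False m by (cases "k = 0") (simp_all add: p_def)
      have "(if even k then j else i) = (if even m then i else j)"
        using m by (auto)
      then have "cayley_edge (if even m then i else j) (p (m + 1)) (p m)"
        unfolding pm pm1 alt_word_snoc
        by (simp add: cayley_edge_iff hurwitz_mult_assoc flip: word_elem_append)
      then show ?thesis by (subst cayley_edge_sym)
    qed
    have "p 0 = g" by (simp add: p_def word_elem_Nil)
    then have "\<gamma> = range p" using alternating_path_range[OF edge] g by simp
    then show "\<gamma> \<in> alt_geodesics_ij i j"
      unfolding alt_geodesics_ij_def
      using alternating_path_geodesic[OF assms edge] edge by blast
  qed
qed

lemma alt_geodesics_eq: "alt_geodesics = {dihedral_coset g i j |g i j. i \<noteq> j}"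
proof -
  have "(\<Union>j\<in>UNIV - {i}. alt_geodesics_ij i j) = (\<Union>j\<in>UNIV - {i}. range (\<lambda>g. dihedral_coset g i j))"
    for i :: 'a
    by (intro SUP_cong refl alt_geodesics_ij_eq) auto
  then have "alt_geodesics = (\<Union>i. \<Union>j\<in>UNIV - {i}. range (\<lambda>g. dihedral_coset (g :: 'a hurwitz_elem) i j))"
    unfolding alt_geodesics_def by (simp only:)
  also have "\<dots> = {dihedral_coset g i j |g i j. i \<noteq> j}"
  proof (rule Set.set_eqI)
    fix \<gamma> :: "'a hurwitz_elem set"
    show "\<gamma> \<in> (\<Union>i. \<Union>j\<in>UNIV - {i}. range (\<lambda>g. dihedral_coset g i j)) \<longleftrightarrow>
        \<gamma> \<in> {dihedral_coset g i j |g i j. i \<noteq> j}"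
      by (simp only: UN_iff mem_Collect_eq Diff_iff UNIV_I image_iff singleton_iff bex_UNIV) blast
  qed
  finally show ?thesis .
qed

section \<open>The Hurwitz map in terms of words\<close>

lemma hurwitz_map_coset:
  assumes "i \<noteq> j"
  shows "hurwitz_map a (dihedral_coset g i j) = (\<Prod>k\<in>UNIV - {i, j}. hurwitz_Phi a g $ k)"
  by (rule hurwitz_map_eq[OF assms _ dihedral_coset_self]) (simp add: alt_geodesics_ij_eq assms)

lemma hurwitz_act_word_elem: "hurwitz_act (word_elem w) = foldr hurwitz_b w"
  unfolding word_elem_def by (simp add: hurwitz_act.abs_eq)

text \<open>Inversion reverses the word, so the letters of a path from the identity act in reading
  order: appending a letter applies one more generator to the current point.\<close>

lemma hurwitz_Phi_word_elem: "hurwitz_Phi a (word_elem w) = fold hurwitz_b w a"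
  unfolding hurwitz_Phi_def inv_word_elem hurwitz_act_word_elem by (simp add: foldr_conv_fold)

lemma hurwitz_Phi_act:
  "hurwitz_Phi (hurwitz_act h a) g = hurwitz_Phi a (hurwitz_mult (inv\<^bsub>hurwitz_group\<^esub> h) g)"
proof -
  interpret group hurwitz_group by (rule group_hurwitz_group)
  have "inv\<^bsub>hurwitz_group\<^esub> (hurwitz_mult (inv\<^bsub>hurwitz_group\<^esub> h) g)
      = hurwitz_mult (inv\<^bsub>hurwitz_group\<^esub> g) h"
    using inv_mult_group[of "inv\<^bsub>hurwitz_group\<^esub> h" g] by simp
  then show ?thesis unfolding hurwitz_Phi_def by (simp add: hurwitz_act_mult)
qed

section \<open>Edge relations\<close>

text \<open>At the point lying over a vertex, this is the value of \<phi> on the geodesic with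
  labels \<open>i\<close> and \<open>j\<close> through that vertex
  (\<open>hurwitz_map_pair_prod\<close>).\<close>

definition pair_prod :: "'n::finite \<Rightarrow> 'n \<Rightarrow> complex ^ 'n \<Rightarrow> complex" where
  "pair_prod i j x = (\<Prod>k\<in>UNIV - {i, j}. x $ k)"

lemma pair_prod_commute: "pair_prod i j x = pair_prod j i x"
  unfolding pair_prod_def by (simp add: insert_commute)

lemma continuous_on_pair_prod [continuous_intros]:
  "continuous_on A f \<Longrightarrow> continuous_on A (\<lambda>x. pair_prod i j (f x))"
  unfolding pair_prod_def by (intro continuous_intros)

lemma continuous_on_hurwitz_b [continuous_intros]:
  assumes "continuous_on A f"
  shows "continuous_on A (\<lambda>x. hurwitz_b i (f x))"
  unfolding hurwitz_b_def
proof (rule continuous_on_vec_lambda)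
  fix k
  show "continuous_on A (\<lambda>x. if k = i then (\<Prod>j\<in>UNIV - {i}. f x $ j) - f x $ i else f x $ k)"
    using assms by (cases "k = i") (auto intro!: continuous_intros)
qed

lemma continuous_on_fold_hurwitz_b [continuous_intros]:
  "continuous_on A f \<Longrightarrow> continuous_on A (\<lambda>x. fold hurwitz_b w (f x))"
proof (induction w arbitrary: f)
  case (Cons i w)
  then show ?case using Cons.IH[OF continuous_on_hurwitz_b[OF Cons.prems, of i]] by simp
qed simp

lemma hurwitz_b_other: "k \<noteq> i \<Longrightarrow> hurwitz_b i x $ k = x $ k"
  by (simp add: hurwitz_b_nth)

text \<open>Splitting off the factor \<open>j\<close> makes the generator linear in the coordinates
  \<open>i\<close> and \<open>j\<close>. The coefficient is constant along the geodesic, so the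
  coordinates changed along it obey a second-order linear recurrence.\<close>

lemma hurwitz_b_self:
  assumes "i \<noteq> j"
  shows "hurwitz_b i x $ i = pair_prod i j x * x $ j - x $ i"
proof -
  have "UNIV - {i} = insert j (UNIV - {i, j})" using assms by auto
  then show ?thesis using assms by (simp add: hurwitz_b_nth pair_prod_def)
qed

lemma pair_prod_hurwitz_b: "pair_prod i j (hurwitz_b i x) = pair_prod i j x"
  unfolding pair_prod_def by (rule prod.cong) (auto simp: hurwitz_b_nth)

lemma pair_prod_split:
  assumes "i \<noteq> j" "i \<noteq> k"
  shows "pair_prod j k x = x $ i * (\<Prod>l\<in>UNIV - {i, j, k}. x $ l)"
proof -
  have "UNIV - {j, k} = insert i (UNIV - {i, j, k})" using assms by auto
  then show ?thesis by (simp add: pair_prod_def)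
qed

text \<open>Coordinate \<open>i\<close> is a factor of \<open>pair_prod j k\<close>, and the
  cofactor does not change, so growth of the coordinate carries over to \<phi>.\<close>

lemma norm_pair_prod_mono:
  assumes "i \<noteq> j" "i \<noteq> k" "c * norm (x $ i) \<le> norm (hurwitz_b i x $ i)"
  shows "c * norm (pair_prod j k x) \<le> norm (pair_prod j k (hurwitz_b i x))"
proof -
  have eq: "(\<Prod>l\<in>UNIV - {i, j, k}. hurwitz_b i x $ l) = (\<Prod>l\<in>UNIV - {i, j, k}. x $ l)"
    by (rule prod.cong) (auto simp: hurwitz_b_nth)
  show ?thesis
    unfolding pair_prod_split[OF assms(1,2)] eq norm_mult
    using mult_right_mono[OF assms(3) norm_ge_zero] by (simp add: mult.assoc)
qed

text \<open>With \<open>Q\<close> the product of the coordinates other than \<open>i\<close>,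
  \<open>j\<close>, \<open>k\<close>, the old and new values of coordinate \<open>i\<close> add up
  to \<open>x $ j * x $ k * Q\<close>; multiplying by \<open>Q\<close> splits this into a product of
  two values of \<phi>.\<close>

lemma pair_prod_edge:
  assumes "i \<noteq> j" "i \<noteq> k" "j \<noteq> k"
  shows "pair_prod j k x + pair_prod j k (hurwitz_b i x) = pair_prod i j x * pair_prod i k x"
proof -
  define Q where "Q = (\<Prod>l\<in>UNIV - {i, j, k}. x $ l)"
  have eq: "(\<Prod>l\<in>UNIV - {i, j, k}. hurwitz_b i x $ l) = Q"
    unfolding Q_def by (rule prod.cong) (auto simp: hurwitz_b_nth)
  have 1: "pair_prod i j x = x $ k * Q" "pair_prod i k x = x $ j * Q"
    using assms pair_prod_split[of k i j x] pair_prod_split[of j i k x]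
    by (simp_all add: Q_def insert_commute)
  show ?thesis
    using assms 1 unfolding pair_prod_split[OF assms(1,2)] eq
    by (simp add: hurwitz_b_self[OF assms(1)] flip: Q_def) (simp add: algebra_simps)
qed

text \<open>A solution of \<open>z (m + 1) = y z m - z (m - 1)\<close>, \<open>y = c + 1 / c\<close>, grows forever as soon as
  the ratio of consecutive terms lies in the disc of radius \<open>\<bar>c\<bar> - 1\<close> about \<open>c\<close>, which the
  recurrence maps into itself. Allowing \<open>y\<close> to differ slightly from \<open>c + 1 / c\<close> makes this
  condition visibly open, and multiplying out the ratio \<open>p / q\<close> keeps it meaningful for
  \<open>q = 0\<close>.\<close>

definition escaping :: "complex \<Rightarrow> complex \<Rightarrow> complex \<Rightarrow> bool" where
  "escaping y p q \<longleftrightarrow> (\<exists>c. norm c > 1 \<and> norm (p - c * q) < (norm c - 1) * norm q \<and>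
     norm (y - c - 1 / c) < (norm c - 1) * (1 - 1 / norm c))"

lemma escaping_imp_less:
  assumes "escaping y p q"
  shows "norm q < norm p"
proof -
  obtain c where c: "norm (p - c * q) < (norm c - 1) * norm q"
    using assms by (auto simp: escaping_def)
  have "norm c * norm q \<le> norm (p - c * q) + norm p"
    using norm_triangle_ineq4[of p "p - c * q"] by (simp add: norm_mult)
  then show ?thesis using c by (simp add: algebra_simps)
qed

lemma escaping_step:
  assumes "escaping y p q"
  shows "escaping y (y * p - q) p"
proof -
  obtain c where c: "norm c > 1" "norm (p - c * q) < (norm c - 1) * norm q"
      "norm (y - c - 1 / c) < (norm c - 1) * (1 - 1 / norm c)"
    using assms by (auto simp: escaping_def)
  have pq: "norm q < norm p" by (rule escaping_imp_less[OF assms])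
  have p0: "norm p > 0" using pq norm_ge_zero[of q] by linarith
  have c0: "c \<noteq> 0" using c(1) by auto
  \<comment> \<open>The new deviation from the ratio \<open>c\<close> is the error in
    \<open>y\<close> plus the old deviation divided by \<open>c\<close>. Relative to
    \<open>norm p\<close>, the two tolerances add up to exactly \<open>norm c - 1\<close>.\<close>
  have "y * p - q - c * p = (y - c - 1 / c) * p + (p - c * q) / c"
    using c0 by (simp add: field_simps)
  then have "norm (y * p - q - c * p) \<le> norm (y - c - 1 / c) * norm p + norm (p - c * q) / norm c"
    by (metis norm_triangle_ineq norm_mult norm_divide)
  also have "\<dots> < (norm c - 1) * (1 - 1 / norm c) * norm p + (norm c - 1) * norm p / norm c"
  proof (rule add_strict_mono)
    show "norm (y - c - 1 / c) * norm p < (norm c - 1) * (1 - 1 / norm c) * norm p"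
      using c(3) p0 by (rule mult_strict_right_mono)
    have "norm (p - c * q) < (norm c - 1) * norm p"
      using c(1,2) mult_left_mono[of "norm q" "norm p" "norm c - 1"] pq by linarith
    then show "norm (p - c * q) / norm c < (norm c - 1) * norm p / norm c"
      using c(1) by (intro divide_strict_right_mono) auto
  qed
  also have "\<dots> = (norm c - 1) * norm p"
    using c0 by (simp add: field_simps)
  finally show ?thesis unfolding escaping_def using c by blast
qed

lemma open_escaping:
  assumes [continuous_intros]: "continuous_on UNIV f" "continuous_on UNIV g" "continuous_on UNIV h"
  shows "open {x::'a::topological_space. escaping (f x) (g x) (h x)}"
  unfolding escaping_def
  by (intro open_Collect_ex open_Collect_conj open_Collect_const open_Collect_less continuous_intros)

text \<open>The first clause expresses growth of the changed coordinate through the recurrence along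
  each geodesic containing the edge. The second concerns the geodesics through the far vertex that
  do not contain the edge. The third lets at most one geodesic containing the edge be small, which a
  ray running along a small geodesic requires.\<close>

definition good_edge :: "real \<Rightarrow> 'n::finite \<Rightarrow> complex ^ 'n \<Rightarrow> bool" where
  "good_edge R i x \<longleftrightarrow>
    (\<forall>j. j \<noteq> i \<longrightarrow> norm (pair_prod i j x) > 2 \<and> norm (hurwitz_b i x $ i) > norm (x $ i) \<or>
       escaping (pair_prod i j x) (hurwitz_b i x $ i) (x $ j)) \<and>
    (\<forall>j k. j \<noteq> i \<longrightarrow> k \<noteq> i \<longrightarrow> j \<noteq> k \<longrightarrow> norm (pair_prod j k (hurwitz_b i x)) > R) \<and>
    (\<exists>l. \<forall>j. j \<noteq> i \<longrightarrow> j \<noteq> l \<longrightarrow> norm (pair_prod i j x) > R)"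

lemma open_Collect_all_finite:
  fixes P :: "'i::finite \<Rightarrow> 'a::topological_space \<Rightarrow> bool"
  shows "(\<And>i. open {x. P i x}) \<Longrightarrow> open {x. \<forall>i. P i x}"
  by (simp add: Collect_all_eq open_INT)

lemma open_Collect_imp_const: "(A \<Longrightarrow> open {x. P x}) \<Longrightarrow> open {x. A \<longrightarrow> P x}"
  by (cases A) auto

lemma open_good_edge: "open {x. good_edge R i x}"
proof -
  have 1: "open {x. r < norm (pair_prod j k x)}" for j k :: 'a and r
    by (intro open_Collect_less continuous_intros)
  have 2: "open {x. R < norm (pair_prod j k (hurwitz_b i x))}" for j k
    by (intro open_Collect_less continuous_intros)
  have 3: "open {x. norm (x $ i) < norm (hurwitz_b i x $ i)}"
    by (intro open_Collect_less continuous_intros)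
  have 4: "open {x. escaping (pair_prod i j x) (hurwitz_b i x $ i) (x $ j)}" for j
    by (intro open_escaping continuous_intros)
  have 5: "open {x. j \<noteq> i \<longrightarrow> 2 < norm (pair_prod i j x) \<and> norm (x $ i) < norm (hurwitz_b i x $ i) \<or>
      escaping (pair_prod i j x) (hurwitz_b i x $ i) (x $ j)}" for j
    by (intro open_Collect_imp_const open_Collect_disj[OF open_Collect_conj[OF 1 3] 4])
  have 6: "open {x. j \<noteq> i \<longrightarrow> k \<noteq> i \<longrightarrow> j \<noteq> k \<longrightarrow> R < norm (pair_prod j k (hurwitz_b i x))}" for j k
    by (rule open_Collect_imp_const)+ (rule 2)
  have 7: "open {x. \<forall>j. j \<noteq> i \<longrightarrow> j \<noteq> l \<longrightarrow> R < norm (pair_prod i j x)}" for l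
    by (rule open_Collect_all_finite, (rule open_Collect_imp_const)+, rule 1)
  show ?thesis
    unfolding good_edge_def
    by (rule open_Collect_conj[OF open_Collect_all_finite[OF 5] open_Collect_conj[OF
          open_Collect_all_finite[OF open_Collect_all_finite[OF 6]] open_Collect_ex[OF 7]]])
qed

text \<open>Coordinate \<open>j\<close> grows, so values of \<phi> for pairs avoiding
  \<open>j\<close> cannot drop. The only such values that may not be large yet pair \<open>i\<close>
  with the exceptional index, and there \<open>pair_prod_edge\<close> gives more than
  \<open>2 * R - R\<close>.\<close>

lemma good_edge_step:
  assumes R: "R \<ge> 2" and good: "good_edge R i x" and ij: "i \<noteq> j"
  shows "good_edge R j (hurwitz_b i x)"
proof -
  define w where "w = hurwitz_b i x"
  define u where "u = hurwitz_b j w"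
  note g = good[unfolded good_edge_def, folded w_def]
  obtain l0 where l0: "\<And>k. k \<noteq> i \<Longrightarrow> k \<noteq> l0 \<Longrightarrow> norm (pair_prod i k x) > R"
    using conjunct2[OF conjunct2[OF g]] by blast
  have G2: "norm (pair_prod k l w) > R" if "k \<noteq> i" "l \<noteq> i" "k \<noteq> l" for k l
    using conjunct1[OF conjunct2[OF g]] that by simp
  have eq: "pair_prod i k w = pair_prod i k x" for k
    unfolding w_def by (rule pair_prod_hurwitz_b)
  have xj: "x $ j = w $ j" unfolding w_def using ij by (simp add: hurwitz_b_other)
  have wi: "w $ i = pair_prod i j x * w $ j - x $ i"
    using hurwitz_b_self[OF ij, of x] by (simp add: w_def xj[unfolded w_def])
  have uj: "u $ j = pair_prod i j x * w $ i - w $ j"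
    using hurwitz_b_self[of j i w] ij eq[of j] by (simp add: u_def pair_prod_commute)
  have "(norm (pair_prod i j x) > 2 \<and> norm (u $ j) > norm (w $ j) \<or>
      escaping (pair_prod i j x) (u $ j) (w $ i)) \<and> norm (u $ j) > norm (w $ j)"
  proof (cases "escaping (pair_prod i j x) (w $ i) (x $ j)")
    case True
    then have "escaping (pair_prod i j x) (u $ j) (w $ i)" using escaping_step xj uj by simp
    with escaping_imp_less[OF True] escaping_imp_less[OF this] show ?thesis using xj by simp
  next
    case False
    let ?y = "pair_prod i j x"
    have a: "norm ?y > 2 \<and> norm (w $ i) > norm (x $ i)"
      using False conjunct1[OF g, rule_format, of j] ij by simp
    \<comment> \<open>\<open>x $ i\<close>, \<open>w $ j\<close>, \<open>w $ i\<close>,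
      \<open>u $ j\<close> are consecutive terms of the recurrence with coefficient
      \<open>?y\<close>. An ascent from the first to the third forces the second below the third,
      and then the fourth above it.\<close>
    have "norm (?y * w $ j) \<le> norm (w $ i) + norm (x $ i)"
      using norm_triangle_ineq[of "w $ i" "x $ i"] wi by simp
    then have 1: "norm ?y * norm (w $ j) < 2 * norm (w $ i)" using a by (simp add: norm_mult)
    have 2: "2 * norm (w $ j) \<le> norm ?y * norm (w $ j)"
      using a by (intro mult_right_mono) auto
    have wi0: "norm (w $ i) > 0" using 1 2 norm_ge_zero[of "w $ j"] by linarith
    have "norm (?y * w $ i) \<le> norm (u $ j) + norm (w $ j)"
      using norm_triangle_ineq[of "u $ j" "w $ j"] uj by simp
    then have 3: "norm ?y * norm (w $ i) \<le> norm (u $ j) + norm (w $ j)" by (simp add: norm_mult)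
    have "2 * norm (w $ i) < norm ?y * norm (w $ i)" using a wi0 by simp
    then show ?thesis using 1 2 3 a by linarith
  qed
  then have ij_case: "norm (pair_prod i j x) > 2 \<and> norm (u $ j) > norm (w $ j) \<or>
      escaping (pair_prod i j x) (u $ j) (w $ i)"
    and asc: "norm (u $ j) > norm (w $ j)" by auto
  have mono: "norm (pair_prod k l u) \<ge> norm (pair_prod k l w)" if "k \<noteq> j" "l \<noteq> j" for k l
    using norm_pair_prod_mono[of j k l 1 w] that asc unfolding u_def by simp
  have il: "norm (pair_prod i l u) > R" if l: "l \<noteq> i" "l \<noteq> j" for l
  proof (cases "norm (pair_prod i l w) > R")
    case True
    then show ?thesis using mono[of i l] ij l by linarith
  next
    case False
    \<comment> \<open>The exception allowed at the old edge is taken by \<open>l\<close>, so the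
      geodesic containing both edges has a large value.\<close>
    then have "l = l0" using l0[of l] l by (auto simp: eq)
    then have yij: "norm (pair_prod i j x) > R" using l0[of j] ij l by auto
    have "pair_prod i l w + pair_prod i l u = pair_prod i j x * pair_prod j l w"
      using pair_prod_edge[of j i l w] ij l eq[of j] unfolding u_def
      by (simp add: pair_prod_commute)
    then have "norm (pair_prod i j x) * norm (pair_prod j l w) \<le> norm (pair_prod i l w) + norm (pair_prod i l u)"
      by (metis norm_mult norm_triangle_ineq)
    moreover have "R * norm (pair_prod j l w) \<le> norm (pair_prod i j x) * norm (pair_prod j l w)"
      using yij by (intro mult_right_mono) auto
    moreover have "2 * norm (pair_prod j l w) \<le> R * norm (pair_prod j l w)"
      using R by (intro mult_right_mono) auto
    moreover have "norm (pair_prod j l w) > R" using G2[of j l] ij l by simp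
    ultimately show ?thesis using False by linarith
  qed
  show ?thesis
    unfolding good_edge_def w_def[symmetric] u_def[symmetric]
  proof (intro conjI allI impI)
    fix k assume k: "k \<noteq> j"
    show "norm (pair_prod j k w) > 2 \<and> norm (u $ j) > norm (w $ j) \<or>
        escaping (pair_prod j k w) (u $ j) (w $ k)"
    proof (cases "k = i")
      case True
      then show ?thesis using ij_case eq[of j] by (simp add: pair_prod_commute)
    next
      case False
      then have "norm (pair_prod j k w) > R" using G2[of j k] k ij by simp
      then show ?thesis using R asc by simp
    qed
  next
    fix k l assume kl: "k \<noteq> j" "l \<noteq> j" "k \<noteq> l"
    show "norm (pair_prod k l u) > R"
    proof (cases "k = i \<or> l = i")
      case True
      then show ?thesis using il kl by (metis pair_prod_commute)
    next
      case False
      then show ?thesis using G2[of k l] mono[of k l] kl by fastforce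
    qed
  next
    \<comment> \<open>Among the geodesics containing the new edge only the one with labels
      \<open>i\<close> and \<open>j\<close> contains the old edge too; the second clause at the old
      edge covers all others.\<close>
    show "\<exists>l. \<forall>k. k \<noteq> j \<longrightarrow> k \<noteq> l \<longrightarrow> norm (pair_prod j k w) > R"
      using G2 ij by (intro exI[of _ i]) auto
  qed
qed

lemma good_edge_extend:
  assumes "R \<ge> 2" "distinct_adj (u @ [i] @ v @ [j])" "good_edge R i (fold hurwitz_b u a)"
  shows "good_edge R j (fold hurwitz_b (u @ [i] @ v) a)"
  using assms(2)
proof (induction v arbitrary: j rule: rev_induct)
  case Nil
  then show ?case using good_edge_step[OF assms(1,3)] by (simp add: distinct_adj_append_iff)
next
  case (snoc k v)
  have d: "distinct_adj ((u @ [i] @ v @ [k]) @ [j])" using snoc.prems by simp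
  then have "distinct_adj (u @ [i] @ v @ [k])" "k \<noteq> j"
    by (auto simp only: distinct_adj_append_iff) auto
  then show ?case using good_edge_step[OF assms(1) snoc.IH] by simp
qed

section \<open>Infinite rays\<close>

lemma third_index:
  fixes i j :: "'n::finite"
  assumes "CARD('n) \<ge> 3"
  obtains k where "k \<noteq> i" "k \<noteq> j"
proof -
  have "card {i, j} < CARD('n)" using assms card_insert_le_m1[of 2 "{j}" i] by simp
  then have "{i, j} \<noteq> UNIV" by auto
  then show ?thesis using that by blast
qed

text \<open>Monotonicity preserves the gain of the infinitely many steps that multiply by at least
  \<open>q\<close>.\<close>

lemma geometric_growth_at_top:
  fixes f :: "nat \<Rightarrow> real"
  assumes mono: "\<And>m. m \<ge> m1 \<Longrightarrow> f m \<le> f (Suc m)"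
    and grow: "\<exists>\<^sub>\<infinity>m. q * f m \<le> f (Suc m)" and q: "q > 1" and pos: "f m1 > 0"
  shows "filterlim f at_top sequentially"
proof -
  have le: "f m \<le> f m'" if "m1 \<le> m" "m \<le> m'" for m m'
    using that(2)
  proof (induction rule: dec_induct)
    case (step k)
    then show ?case using mono[of k] that(1) by linarith
  qed simp
  have "\<exists>m\<ge>m1. q ^ N * f m1 \<le> f m" for N
  proof (induction N)
    case (Suc N)
    then obtain m where m: "m \<ge> m1" "q ^ N * f m1 \<le> f m" by blast
    obtain m' where m': "m' \<ge> m" "q * f m' \<le> f (Suc m')"
      using grow unfolding INFM_nat_le by blast
    have "q * (q ^ N * f m1) \<le> q * f m'"
      using q m(2) le[of m m'] m(1) m'(1) by (intro mult_left_mono) auto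
    then show ?case using m m' by (intro exI[of _ "Suc m'"]) auto
  qed auto
  note * = this
  show ?thesis
    unfolding filterlim_at_top
  proof
    fix Z :: real
    obtain N where "Z / f m1 < q ^ N" using real_arch_pow[OF q] by blast
    then have N: "Z \<le> q ^ N * f m1" using pos by (simp add: field_simps)
    obtain m where m: "m \<ge> m1" "q ^ N * f m1 \<le> f m" using * by blast
    have "\<forall>m'\<ge>m. Z \<le> f m'" using N m le by (meson order_trans)
    then show "eventually (\<lambda>m. Z \<le> f m) sequentially" by (auto simp: eventually_sequentially)
  qed
qed

lemma edge_norm_bound:
  fixes y p q :: complex
  assumes "p' = y * p - q" "norm y > K"
  shows "K * norm p \<le> norm p' + norm q"
proof -
  have "norm (y * p) \<le> norm p' + norm q"
    using norm_triangle_ineq[of p' q] assms(1) by simp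
  moreover have "K * norm p \<le> norm y * norm p" using assms(2) by (intro mult_right_mono) auto
  ultimately show ?thesis by (simp add: norm_mult)
qed

text \<open>The coordinates involved are four consecutive terms z0, z1, z2, z3 of the recurrence
  along the geodesic containing the edges \<open>m\<close> and \<open>Suc m\<close>; the bounds are
  its triangle inequality at the inner terms z1 and z2.\<close>

lemma hurwitz_ray_neighbours:
  fixes s :: "nat \<Rightarrow> 'n::finite" and x :: "nat \<Rightarrow> complex ^ 'n"
  assumes step: "\<And>m. x (Suc m) = hurwitz_b (s m) (x m)" and adj: "\<And>m. s m \<noteq> s (Suc m)"
    and big: "\<And>i j. i \<noteq> j \<Longrightarrow> norm (pair_prod i j (x m)) > K"
  shows "K * norm (x (Suc m) $ s (Suc m)) \<le> norm (x (Suc m) $ s m) + norm (x m $ s m)"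
    and "K * norm (x (Suc m) $ s m) \<le> norm (x (Suc (Suc m)) $ s (Suc m)) + norm (x (Suc m) $ s (Suc m))"
proof -
  let ?i = "s m" and ?j = "s (Suc m)"
  have "x m $ ?j = x (Suc m) $ ?j" using adj[of m] by (simp add: step hurwitz_b_other)
  then have "x (Suc m) $ ?i = pair_prod ?i ?j (x m) * x (Suc m) $ ?j - x m $ ?i"
    using hurwitz_b_self[OF adj[of m], of "x m"] step[of m] by simp
  then show "K * norm (x (Suc m) $ ?j) \<le> norm (x (Suc m) $ ?i) + norm (x m $ ?i)"
    by (rule edge_norm_bound) (simp add: big adj)
  have "pair_prod ?i ?j (x m) = pair_prod ?j ?i (x (Suc m))"
    unfolding step by (simp add: pair_prod_hurwitz_b pair_prod_commute[of ?j])
  then have "x (Suc (Suc m)) $ ?j = pair_prod ?i ?j (x m) * x (Suc m) $ ?i - x (Suc m) $ ?j"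
    using hurwitz_b_self[OF adj[of m, symmetric], of "x (Suc m)"] step[of "Suc m"] by simp
  then show "K * norm (x (Suc m) $ ?i) \<le> norm (x (Suc (Suc m)) $ ?j) + norm (x (Suc m) $ ?j)"
    by (rule edge_norm_bound) (simp add: big adj)
qed

text \<open>Permanent descent would be geometric and drive a value of \<phi> to 0, against
  \<open>big\<close>. After one ascent every later step multiplies its coordinate by at least
  \<open>K - 1\<close>; as each pair of labels is left infinitely often, all values of \<phi> tend
  to infinity.\<close>

lemma ray_good_edge_nonalternating:
  fixes s :: "nat \<Rightarrow> 'n::finite" and x :: "nat \<Rightarrow> complex ^ 'n"
  assumes n: "CARD('n) \<ge> 3" and K: "K > 2"
    and step: "\<And>m. x (Suc m) = hurwitz_b (s m) (x m)" and adj: "\<And>m. s m \<noteq> s (Suc m)"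
    and big: "\<And>m i j. m \<ge> m0 \<Longrightarrow> i \<noteq> j \<Longrightarrow> norm (pair_prod i j (x m)) > K"
    and nonalt: "\<And>i j. i \<noteq> j \<Longrightarrow> \<exists>\<^sub>\<infinity>m. s m \<notin> {i, j}"
  shows "\<exists>m. good_edge R (s m) (x m)"
proof -
  note nb = hurwitz_ray_neighbours[where K = K and x = x and s = s, OF step adj big]
  have stay: "pair_prod i j (x (Suc m)) = pair_prod i j (x m)" if "s m \<in> {i, j}" for i j m
    unfolding step using that pair_prod_hurwitz_b pair_prod_commute by (metis empty_iff insert_iff)
  have nonalt': "\<exists>\<^sub>\<infinity>m. m \<ge> m1 \<and> s m \<notin> {i, j}" if nij: "i \<noteq> j" for m1 :: nat and i j
    unfolding INFM_nat_le
  proof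
    fix k
    obtain m where "m \<ge> max k m1" "s m \<notin> {i, j}"
      using nonalt[OF nij] unfolding INFM_nat_le by blast
    then show "\<exists>m\<ge>k. m \<ge> m1 \<and> s m \<notin> {i, j}" by auto
  qed
  have ex_asc: "\<exists>m1\<ge>m0. norm (x (Suc m1) $ s m1) > norm (x m1 $ s m1)"
  proof (rule ccontr)
    assume "\<not> ?thesis"
    then have desc: "norm (x (Suc m) $ s m) \<le> norm (x m $ s m)" if "m \<ge> m0" for m
      using that by force
    \<comment> \<open>In the notation z0, ..., z3 of the recurrence, descent gives |z3| \<le> |z1|.
      Then K|z2| \<le> 2|z1| forces |z2| \<le> |z1|, and K|z1| \<le> |z2| + |z0| yields the
      factor.\<close>
    have fall: "(K - 1) * norm (x (Suc m) $ s m) \<le> norm (x m $ s m)" if m: "m \<ge> m0" for m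
    proof -
      have "K * norm (x (Suc m) $ s m) \<le> 2 * norm (x (Suc m) $ s (Suc m))"
        using nb(2)[OF m] desc[of "Suc m"] m by simp
      moreover have "2 * norm (x (Suc m) $ s m) \<le> K * norm (x (Suc m) $ s m)"
        using K by (intro mult_right_mono) auto
      ultimately have "K * norm (x (Suc m) $ s m) \<le> K * norm (x (Suc m) $ s (Suc m))"
        using K by (intro mult_left_mono) auto
      then show ?thesis using nb(1)[OF m] by (simp add: algebra_simps)
    qed
    obtain i j :: 'n where ij: "i \<noteq> j" using adj by blast
    \<comment> \<open>Reciprocals turn decay into growth, so that
      \<open>geometric_growth_at_top\<close> serves both halves of the proof.\<close>
    define f where "f = (\<lambda>m. 1 / norm (pair_prod i j (x m)))"
    have pos: "norm (pair_prod i j (x m)) > K" if "m \<ge> m0" for m using big[OF that ij] .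
    have shrink: "c * norm (pair_prod i j (x (Suc m))) \<le> norm (pair_prod i j (x m))"
      if "s m \<notin> {i, j}" "c * norm (x (Suc m) $ s m) \<le> norm (x m $ s m)" for c m
      using norm_pair_prod_mono[of "s m" i j c "x (Suc m)"] that
      by (simp add: step hurwitz_b_involution)
    have "filterlim f at_top sequentially"
    proof (rule geometric_growth_at_top[where ?m1.0 = m0 and q = "K - 1"])
      fix m assume m: "m \<ge> m0"
      have "norm (pair_prod i j (x (Suc m))) \<le> norm (pair_prod i j (x m))"
        using shrink[of m 1] stay[of m i j] desc[OF m] by (cases "s m \<in> {i, j}") auto
      then show "f m \<le> f (Suc m)"
        unfolding f_def using pos[of m] pos[of "Suc m"] m K
        by (intro divide_left_mono mult_pos_pos) auto
    next
      show "\<exists>\<^sub>\<infinity>m. (K - 1) * f m \<le> f (Suc m)"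
        using nonalt'[OF ij, of m0]
      proof (rule INFM_mono)
        fix m assume m: "m \<ge> m0 \<and> s m \<notin> {i, j}"
        have "norm (pair_prod i j (x m)) > 0" "norm (pair_prod i j (x (Suc m))) > 0"
          using pos[of m] pos[of "Suc m"] m K by linarith+
        moreover have "(K - 1) * norm (pair_prod i j (x (Suc m))) \<le> norm (pair_prod i j (x m))"
          using shrink[of m "K - 1"] fall[of m] m by blast
        ultimately show "(K - 1) * f m \<le> f (Suc m)"
          unfolding f_def by (simp add: divide_simps)
      qed
    next
      show "f m0 > 0" unfolding f_def using pos[of m0] K by auto
    qed (use K in simp)
    then have "eventually (\<lambda>m. f m \<ge> 1 \<and> m \<ge> m0) sequentially"
      by (intro eventually_conj eventually_ge_at_top) (auto simp: filterlim_at_top)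
    then obtain m where "f m \<ge> 1" "m \<ge> m0" by (auto simp: eventually_sequentially)
    moreover have "f m < 1"
      unfolding f_def using pos[OF \<open>m \<ge> m0\<close>] K by (intro divide_less_eq_1_pos[THEN iffD2]) linarith+
    ultimately show False by simp
  qed
  then obtain m1 where m1: "m1 \<ge> m0" "norm (x (Suc m1) $ s m1) > norm (x m1 $ s m1)" by blast
  \<comment> \<open>An ascent from z0 to z2 forces |z1| < |z2| and hence |z3| > (K - 1)|z1|, so
    ascents propagate.\<close>
  have rise1: "(K - 1) * norm (x (Suc m) $ s (Suc m)) \<le> norm (x (Suc (Suc m)) $ s (Suc m)) \<and>
      norm (x (Suc m) $ s (Suc m)) < norm (x (Suc (Suc m)) $ s (Suc m))"
    if m: "m \<ge> m0" and asc: "norm (x (Suc m) $ s m) > norm (x m $ s m)" for m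
  proof -
    have a: "K * norm (x (Suc m) $ s (Suc m)) < 2 * norm (x (Suc m) $ s m)"
      using nb(1)[OF m] asc by simp
    have b: "2 * norm (x (Suc m) $ s (Suc m)) \<le> K * norm (x (Suc m) $ s (Suc m))"
      using K by (intro mult_right_mono) auto
    then have "K * norm (x (Suc m) $ s (Suc m)) < K * norm (x (Suc m) $ s m)"
      using a K by (intro mult_strict_left_mono) auto
    then have c: "(K - 1) * norm (x (Suc m) $ s (Suc m)) < norm (x (Suc (Suc m)) $ s (Suc m))"
      using nb(2)[OF m] by (simp add: algebra_simps)
    moreover have "1 * norm (x (Suc m) $ s (Suc m)) \<le> (K - 1) * norm (x (Suc m) $ s (Suc m))"
      using K by (intro mult_right_mono) auto
    ultimately show ?thesis by simp
  qed
  have asc: "norm (x (Suc m) $ s m) > norm (x m $ s m)" if "m \<ge> m1" for m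
    using that
  proof (induction rule: dec_induct)
    case (step m)
    then show ?case using rise1[of m] m1(1) by simp
  qed (rule m1(2))
  have rise: "(K - 1) * norm (x m $ s m) \<le> norm (x (Suc m) $ s m)" if "m \<ge> Suc m1" for m
    using that rise1[of "m - 1"] asc[of "m - 1"] m1(1) by simp
  have lim: "filterlim (\<lambda>m. norm (pair_prod i j (x m))) at_top sequentially" if ij: "i \<noteq> j" for i j
  proof (rule geometric_growth_at_top[where ?m1.0 = "Suc m1" and q = "K - 1"])
    fix m assume m: "m \<ge> Suc m1"
    show "norm (pair_prod i j (x m)) \<le> norm (pair_prod i j (x (Suc m)))"
      using norm_pair_prod_mono[of "s m" i j 1 "x m"] stay[of m i j] asc[of m] m
      by (cases "s m \<in> {i, j}") (auto simp: step)
  next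
    show "\<exists>\<^sub>\<infinity>m. (K - 1) * norm (pair_prod i j (x m)) \<le> norm (pair_prod i j (x (Suc m)))"
      using nonalt'[OF ij, of "Suc m1"]
    proof (rule INFM_mono)
      fix m assume m: "m \<ge> Suc m1 \<and> s m \<notin> {i, j}"
      show "(K - 1) * norm (pair_prod i j (x m)) \<le> norm (pair_prod i j (x (Suc m)))"
        using norm_pair_prod_mono[of "s m" i j "K - 1" "x m"] rise[of m] m by (auto simp: step)
    qed
  next
    show "norm (pair_prod i j (x (Suc m1))) > 0" using big[of "Suc m1" i j] m1(1) ij K by linarith
  qed (use K in simp)
  have "\<forall>\<^sub>F m in sequentially. \<forall>i j. i \<noteq> j \<longrightarrow> norm (pair_prod i j (x m)) > R"
    by (intro eventually_all_finite) (use lim in \<open>auto simp: filterlim_at_top_dense\<close>)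
  then obtain M where M: "\<And>m i j. m \<ge> M \<Longrightarrow> i \<noteq> j \<Longrightarrow> norm (pair_prod i j (x m)) > R"
    by (auto simp: eventually_sequentially)
  define m where "m = max M m1"
  have "norm (pair_prod (s m) j (x m)) > 2" if "j \<noteq> s m" for j
    using big[of m "s m" j] m1(1) that K by (fastforce simp: m_def)
  then have "good_edge R (s m) (x m)"
    unfolding good_edge_def step[symmetric]
    using M[of m] M[of "Suc m"] asc[of m] by (auto simp: m_def)
  then show ?thesis by blast
qed

text \<open>The roots of c^2 - y c + 1 are inverse to each other, so one lies outside the unit
  circle unless both lie on it; in that case y = 2 Re c is in [-2,2].\<close>

lemma complex_eigenvalue:
  assumes "y \<notin> complex_of_real ` {-2..2}"
  obtains c where "norm c > 1" "y = c + 1 / c"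
proof -
  define c where "c = (y + csqrt (y\<^sup>2 - 4)) / 2"
  have "(csqrt (y\<^sup>2 - 4))\<^sup>2 = y\<^sup>2 - 4" by simp
  then have c: "c * (y - c) = 1"
    unfolding c_def by (simp add: field_simps power2_eq_square)
  then have c0: "c \<noteq> 0" by auto
  have y: "y = c + 1 / c" using c c0 by (simp add: field_simps)
  consider "norm c > 1" | "norm c < 1" | "norm c = 1" by linarith
  then show ?thesis
  proof cases
    case 1
    then show ?thesis using that y by blast
  next
    case 2
    then have "norm (1 / c) > 1" using c0 by (simp add: norm_divide)
    then show ?thesis using that[of "1 / c"] y c0 by (simp add: add.commute)
  next
    case 3
    then have "c * cnj c = 1" by (simp flip: complex_norm_square)
    then have "1 / c = cnj c" using c0 by (simp add: field_simps)
    then have "y = complex_of_real (2 * Re c)" using y by (simp add: complex_eq_iff)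
    moreover have "\<bar>Re c\<bar> \<le> 1" using abs_Re_le_cmod[of c] 3 by simp
    ultimately have "y \<in> complex_of_real ` {-2..2}"
      by (intro image_eqI[of _ _ "2 * Re c"]) (auto simp: abs_le_iff)
    then show ?thesis using assms by blast
  qed
qed

text \<open>From time \<open>m0\<close> on the ray follows one geodesic, and the changed coordinate
  is a combination of \<open>e ^ t\<close> and \<open>1 / e ^ t\<close>. If the growing part
  vanished, geodesics branching off would be small infinitely often, against \<open>small\<close>.
  So the solution escapes, and eventually every clause of \<open>good_edge\<close> holds.\<close>

lemma ray_good_edge_alternating:
  fixes s :: "nat \<Rightarrow> 'n::finite" and x :: "nat \<Rightarrow> complex ^ 'n"
  assumes n: "CARD('n) \<ge> 3" and K: "K > 2" and R: "R \<ge> 2"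
    and step: "\<And>m. x (Suc m) = hurwitz_b (s m) (x m)" and adj: "\<And>m. s m \<noteq> s (Suc m)"
    and nonreal: "\<And>m i j. i \<noteq> j \<Longrightarrow> pair_prod i j (x m) \<notin> complex_of_real ` {-2..2}"
    and small: "\<And>i j. i \<noteq> j \<Longrightarrow> \<exists>\<^sub>\<infinity>m. norm (pair_prod i j (x m)) \<le> K \<Longrightarrow> \<exists>m0. \<forall>m\<ge>m0. s m \<in> {i, j}"
    and alt: "\<And>m. m \<ge> m0 \<Longrightarrow> s m \<in> {i0, j0}"
  shows "\<exists>m. good_edge R (s m) (x m)"
proof -
  define p q where "p = s m0" and "q = s (Suc m0)"
  define c where "c = (\<lambda>t. s (m0 + t))"
  define d where "d = (\<lambda>t. s (m0 + Suc t))"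
  have pq: "p \<noteq> q" unfolding p_def q_def by (rule adj)
  have cS: "c (Suc t) = d t" for t by (simp add: c_def d_def)
  have cd: "c t \<noteq> d t" for t using adj[of "m0 + t"] by (simp add: c_def d_def)
  have dS: "d (Suc t) = c t" for t
    using adj[of "m0 + t"] adj[of "m0 + Suc t"] alt[of "m0 + t"] alt[of "m0 + Suc t"]
      alt[of "m0 + Suc (Suc t)"] by (auto simp: c_def d_def)
  have set_cd: "{c t, d t} = {p, q}" for t
  proof (induction t)
    case (Suc t)
    then show ?case unfolding cS dS by (simp add: insert_commute)
  qed (simp add: c_def d_def p_def q_def)
  define X where "X = (\<lambda>t. x (m0 + t))"
  have XS: "X (Suc t) = hurwitz_b (c t) (X t)" for t by (simp add: X_def c_def step)
  define y where "y = pair_prod p q (X 0)"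
  have Y: "pair_prod (c t) (d t) (X t) = y" for t
  proof (induction t)
    case (Suc t)
    then show ?case
      unfolding cS dS XS by (simp add: pair_prod_commute[of "d t"] pair_prod_hurwitz_b)
  qed (simp add: y_def c_def d_def p_def q_def)
  have const: "X t $ k = X 0 $ k" if "k \<notin> {p, q}" for k t
  proof (induction t)
    case (Suc t)
    have "k \<noteq> c t" using that set_cd[of t] by blast
    then show ?case using Suc by (simp add: XS hurwitz_b_other)
  qed simp
  define C where "C = (\<lambda>l. \<Prod>k\<in>UNIV - {p, q, l}. X 0 $ k)"
  \<comment> \<open>A zero coordinate would make \<phi> vanish on a geodesic whose labels avoid it,
    and 0 is an excluded value.\<close>
  have nz: "X 0 $ k \<noteq> 0" for k
  proof
    assume k: "X 0 $ k = 0"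
    obtain i where i: "i \<noteq> k" using third_index[OF n] by blast
    obtain j where j: "j \<noteq> k" "j \<noteq> i" using third_index[OF n] by blast
    have "pair_prod i j (X 0) = 0"
      unfolding pair_prod_split[of k i j, OF i[symmetric] j(1)[symmetric]] k by simp
    moreover have "(0::complex) \<in> complex_of_real ` {-2..2}" by (intro image_eqI[of _ _ 0]) auto
    ultimately show False using nonreal[of i j m0] j by (auto simp: X_def)
  qed
  have C0: "C l \<noteq> 0" for l using nz by (simp add: C_def)
  \<comment> \<open>The coordinate about to be changed at time \<open>t\<close>; by
    \<open>zd\<close> the other moving coordinate is the next term.\<close>
  define z where "z = (\<lambda>t. X t $ c t)"
  have zd: "X t $ d t = z (Suc t)" for t
    using cd[of t] by (simp add: z_def XS cS hurwitz_b_other)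
  have rec: "z (Suc (Suc t)) = y * z (Suc t) - z t" for t
    using hurwitz_b_self[OF cd[of t], of "X t"] zd[of "Suc t"] zd[of t]
    by (simp add: Y dS flip: XS) (simp add: z_def)
  have Yl: "pair_prod (c t) l (X t) = z (Suc t) * C l" if "l \<notin> {p, q}" for t l
  proof -
    have "d t \<noteq> l" using that set_cd[of t] by blast
    then have "pair_prod (c t) l (X t) = z (Suc t) * (\<Prod>k\<in>UNIV - {d t, c t, l}. X t $ k)"
      using pair_prod_split[of "d t" "c t" l "X t"] cd[of t] by (simp add: zd)
    also have "{d t, c t, l} = {p, q, l}" using set_cd[of t] by blast
    also have "(\<Prod>k\<in>UNIV - {p, q, l}. X t $ k) = C l"
      unfolding C_def by (rule prod.cong) (auto intro: const)
    finally show ?thesis .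
  qed
  have "y \<notin> complex_of_real ` {-2..2}"
    using nonreal[OF pq, of m0] by (simp add: y_def X_def)
  then obtain e where e: "norm e > 1" "y = e + 1 / e" by (rule complex_eigenvalue)
  have e0: "e \<noteq> 0" using e(1) by auto
  \<comment> \<open>\<open>u\<close> and \<open>v\<close> are, up to scaling, the components of the
    solution for the eigenvalues \<open>e\<close> and \<open>1 / e\<close>.\<close>
  define u where "u = (\<lambda>t. z (Suc t) - z t / e)"
  define v where "v = (\<lambda>t. z (Suc t) - e * z t)"
  have u: "u t = e ^ t * u 0" for t
  proof (induction t)
    case (Suc t)
    have "u (Suc t) = e * u t" using e0 by (simp add: u_def rec e(2) field_simps)
    then show ?case using Suc by simp
  qed simp
  have v: "v t = v 0 / e ^ t" for t
  proof (induction t)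
    case (Suc t)
    have "v (Suc t) = v t / e" using e0 by (simp add: v_def rec e(2) field_simps)
    then show ?case using Suc by simp
  qed simp
  have pow: "\<exists>N. \<forall>t\<ge>N. norm e ^ t > B" for B
  proof -
    obtain N where "B < norm e ^ N" using real_arch_pow[OF e(1)] by blast
    moreover have "norm e ^ N \<le> norm e ^ t" if "t \<ge> N" for t
      using that e(1) by (intro power_increasing) auto
    ultimately show ?thesis by (meson less_le_trans)
  qed
  have u0: "u 0 \<noteq> 0"
  proof
    assume "u 0 = 0"
    then have "z (Suc t) = z t / e" for t using u[of t] by (simp add: u_def)
    then have z: "z t = z 0 / e ^ t" for t by (induction t) (simp_all add: field_simps)
    obtain l where l: "l \<noteq> p" "l \<noteq> q" using third_index[OF n] by blast
    obtain N where N: "\<And>t. t \<ge> N \<Longrightarrow> norm e ^ t > norm (z 0 * C l)" using pow by blast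
    have sm: "norm (z t * C l) \<le> K" if "t \<ge> N" for t
    proof -
      have "norm (z t * C l) = norm (z 0 * C l) / norm e ^ t"
        by (simp add: z[of t] norm_mult norm_divide norm_power)
      also have "\<dots> \<le> 1" using N[OF that] e0 by (simp add: divide_le_eq_1)
      finally show ?thesis using K by simp
    qed
    \<comment> \<open>\<open>small\<close> concerns a fixed pair of labels. At even times the label
      to be used is \<open>p\<close>, so the small values all belong to the pair \<open>p\<close>,
      \<open>l\<close>.\<close>
    have per: "c (2 * k) = p \<and> d (2 * k) = q" for k
    proof (induction k)
      case (Suc k)
      then show ?case using cS dS by simp
    qed (simp add: c_def d_def p_def q_def)
    have "\<exists>\<^sub>\<infinity>m. norm (pair_prod p l (x m)) \<le> K"
      unfolding INFM_nat_le
    proof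
      fix k
      have "pair_prod p l (X (2 * (k + N))) = z (Suc (2 * (k + N))) * C l"
        using Yl[of l "2 * (k + N)"] l per[of "k + N"] by simp
      then have "norm (pair_prod p l (x (m0 + 2 * (k + N)))) \<le> K"
        using sm[of "Suc (2 * (k + N))"] by (simp add: X_def)
      then show "\<exists>m\<ge>k. norm (pair_prod p l (x m)) \<le> K"
        by (intro exI[of _ "m0 + 2 * (k + N)"]) simp
    qed
    \<comment> \<open>The ray cannot keep to the labels \<open>p\<close> and \<open>l\<close>, since
      \<open>q\<close> recurs.\<close>
    then obtain m1 where m1: "\<forall>m\<ge>m1. s m \<in> {p, l}" using small[of p l] l by blast
    have "d (2 * m1) \<in> {p, l}" unfolding d_def by (rule m1[rule_format]) simp
    then show False using per[of m1] pq l by auto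
  qed
  have e1: "e - 1 / e \<noteq> 0"
  proof
    assume "e - 1 / e = 0"
    then have "e * e = 1" using e0 by (simp add: field_simps)
    then have "norm e * norm e = 1" by (metis norm_mult norm_one)
    then show False using e(1) by (metis less_irrefl mult_1 mult_strict_mono' norm_ge_zero zero_le_one)
  qed
  have zbig: "\<exists>N. \<forall>t\<ge>N. norm (z t) > B" for B
  proof -
    obtain N where N: "\<And>t. t \<ge> N \<Longrightarrow> norm e ^ t > (B * norm (e - 1 / e) + norm (v 0)) / norm (u 0)"
      using pow by blast
    have "norm (z t) > B" if "t \<ge> N" for t
    proof -
      have "(e - 1 / e) * z t = u t - v t" by (simp add: u_def v_def field_simps)
      then have "norm (e - 1 / e) * norm (z t) \<ge> norm (u t) - norm (v t)"
        by (metis norm_mult norm_triangle_ineq2)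
      moreover have "norm (v t) \<le> norm (v 0)"
        using e(1) one_le_power[of "norm e" t]
        by (simp add: v[of t] norm_divide norm_power divide_le_eq mult_le_cancel_left1)
      moreover have "norm (u t) > B * norm (e - 1 / e) + norm (v 0)"
        using N[OF that] u0 by (simp add: u[of t] norm_mult norm_power field_simps)
      ultimately have "norm (e - 1 / e) * B < norm (e - 1 / e) * norm (z t)" by (simp add: mult.commute)
      then show ?thesis using e1 by (simp add: mult_less_cancel_left)
    qed
    then show ?thesis by blast
  qed
  have "\<forall>\<^sub>F t in sequentially. \<forall>l. norm (z t) > R / norm (C l)"
    by (intro eventually_all_finite) (use zbig in \<open>auto simp: eventually_sequentially\<close>)
  then obtain N1 where N1: "\<And>t l. t \<ge> N1 \<Longrightarrow> norm (z t * C l) > R"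
    using C0 by (auto simp: eventually_sequentially norm_mult field_simps)
  obtain N2 where N2: "\<And>t. t \<ge> N2 \<Longrightarrow> norm (z t) > norm (v 0) / (norm e - 1)" using zbig by blast
  have esc: "escaping y (z (Suc t)) (z t)" if "t \<ge> N2" for t
  proof -
    have "norm (v t) \<le> norm (v 0)"
      using e(1) one_le_power[of "norm e" t]
      by (simp add: v[of t] norm_divide norm_power divide_le_eq mult_le_cancel_left1)
    also have "\<dots> < (norm e - 1) * norm (z t)" using N2[OF that] e(1) by (simp add: field_simps)
    finally have "norm (z (Suc t) - e * z t) < (norm e - 1) * norm (z t)" by (simp add: v_def)
    moreover have "norm (y - e - 1 / e) < (norm e - 1) * (1 - 1 / norm e)"
      using e by (auto intro!: mult_pos_pos simp: divide_less_eq)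
    ultimately show ?thesis unfolding escaping_def using e(1) by blast
  qed
  define t where "t = max N1 N2"
  have t: "t \<ge> N1" "t \<ge> N2" by (simp_all add: t_def)
  let ?w = "hurwitz_b (c t) (X t)"
  have wc: "?w $ c t = z (Suc (Suc t))" using zd[of "Suc t"] by (simp add: dS XS)
  have asc: "norm (?w $ c t) > norm (X t $ c t)"
    using escaping_imp_less[OF esc[of t]] escaping_imp_less[OF esc[of "Suc t"]] t wc
    by (simp add: z_def)
  have Ycl: "norm (pair_prod (c t) l (X t)) > R" if "l \<notin> {c t, d t}" for l
    using Yl[of l t] N1[of "Suc t" l] that t by (simp add: set_cd)
  have "good_edge R (c t) (X t)"
    unfolding good_edge_def
  proof (intro conjI allI impI)
    fix j assume j: "j \<noteq> c t"
    show "norm (pair_prod (c t) j (X t)) > 2 \<and> norm (?w $ c t) > norm (X t $ c t) \<or>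
        escaping (pair_prod (c t) j (X t)) (?w $ c t) (X t $ j)"
    proof (cases "j = d t")
      case True
      then show ?thesis using esc[of "Suc t"] t by (simp add: Y wc zd)
    next
      case False
      then show ?thesis using Ycl[of j] j asc R by simp
    qed
  next
    fix j k assume jk: "j \<noteq> c t" "k \<noteq> c t" "j \<noteq> k"
    have dl: "norm (pair_prod (d t) l ?w) > R" if "l \<notin> {c t, d t}" for l
      using Yl[of l "Suc t"] N1[of "Suc (Suc t)" l] that t by (simp add: set_cd cS XS)
    show "norm (pair_prod j k ?w) > R"
    proof (cases "d t \<in> {j, k}")
      case True
      then show ?thesis
        using dl[of j] dl[of k] jk by (auto simp: pair_prod_commute)
    next
      case False
      then have a: "norm (pair_prod (c t) j (X t)) > R" "norm (pair_prod (c t) k (X t)) > R"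
        using Ycl jk by auto
      have "norm (pair_prod (c t) j (X t) * pair_prod (c t) k (X t)) \<le>
          norm (pair_prod j k (X t)) + norm (pair_prod j k ?w)"
        by (subst pair_prod_edge[symmetric]) (use jk in \<open>auto intro: norm_triangle_ineq\<close>)
      moreover have "norm (pair_prod j k (X t)) \<le> norm (pair_prod j k ?w)"
        using norm_pair_prod_mono[of "c t" j k 1 "X t"] asc jk by simp
      moreover have "2 * R < norm (pair_prod (c t) j (X t)) * norm (pair_prod (c t) k (X t))"
        using a R by (intro mult_le_less_imp_less) auto
      ultimately show ?thesis by (simp add: norm_mult)
    qed
  next
    show "\<exists>l. \<forall>j. j \<noteq> c t \<longrightarrow> j \<noteq> l \<longrightarrow> norm (pair_prod (c t) j (X t)) > R"
      using Ycl by auto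
  qed
  then show ?thesis unfolding c_def X_def by blast
qed

section \<open>The domain\<close>

text \<open>Koenig's lemma: \<open>ext w\<close> says that \<open>w\<close> has continuations in
  \<open>P\<close> of every length, and as the alphabet is finite some next letter always preserves
  this.\<close>

lemma koenig_words:
  fixes P :: "'n::finite list \<Rightarrow> bool"
  assumes prefix: "\<And>u v. P (u @ v) \<Longrightarrow> P u" and ex: "\<And>N. \<exists>w. length w = N \<and> P w"
  obtains s where "\<And>N. P (map s [0..<N])"
proof -
  define ext where "ext = (\<lambda>w. \<forall>N. \<exists>v. length v = N \<and> P (w @ v))"
  have step: "\<exists>i. ext (w @ [i])" if w: "ext w" for w
  proof (rule ccontr)
    assume "\<not> ?thesis"
    then have "\<forall>i. \<exists>N. \<forall>v. length v = N \<longrightarrow> \<not> P (w @ [i] @ v)" by (auto simp: ext_def)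
    then obtain N where N: "\<And>i v. length v = N i \<Longrightarrow> \<not> P (w @ [i] @ v)" by metis
    obtain v where v: "length v = Suc (Max (range N))" "P (w @ v)" using w by (auto simp: ext_def)
    then obtain i v' where iv: "v = i # v'" "length v' = Max (range N)" by (auto simp: length_Suc_conv)
    have "N i \<le> length v'" unfolding iv by (intro Max_ge) auto
    then have "length (take (N i) v') = N i" by simp
    moreover have "P ((w @ [i] @ take (N i) v') @ drop (N i) v')" using v(2) iv(1) by simp
    ultimately show False using N prefix by blast
  qed
  define W where "W = rec_nat [] (\<lambda>_ w. w @ [SOME i. ext (w @ [i])])"
  define s where "s = (\<lambda>n. SOME i. ext (W n @ [i]))"
  have WS: "W (Suc n) = W n @ [s n]" for n by (simp add: W_def s_def)
  have "ext (W n)" for n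
  proof (induction n)
    case 0
    show ?case using ex by (simp add: ext_def W_def)
  next
    case (Suc n)
    then show ?case unfolding WS s_def by (rule someI_ex[OF step])
  qed
  then have "P (W n)" for n
    unfolding ext_def by (metis append_Nil2 length_0_conv)
  moreover have "W n = map s [0..<n]" for n
    by (induction n) (simp_all add: WS, simp add: W_def)
  ultimately show ?thesis by (intro that[of s]) metis
qed

definition hurwitz_domain :: "(complex ^ 'n::finite) set" where
  "hurwitz_domain = {a.
      (\<forall>\<gamma>\<in>alt_geodesics. hurwitz_map a \<gamma> \<notin> complex_of_real ` {-2..2}) \<and>
      (\<exists>K::real. K > 2 \<and> finite {\<gamma> \<in> alt_geodesics. norm (hurwitz_map a \<gamma>) \<le> K})}"

lemma hurwitz_map_pair_prod:
  "i \<noteq> j \<Longrightarrow> hurwitz_map a (dihedral_coset g i j) = pair_prod i j (hurwitz_Phi a g)"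
  by (simp add: hurwitz_map_coset pair_prod_def)

lemma hurwitz_map_word:
  "i \<noteq> j \<Longrightarrow> hurwitz_map a (dihedral_coset (word_elem w) i j) = pair_prod i j (fold hurwitz_b w a)"
  by (simp add: hurwitz_map_pair_prod hurwitz_Phi_word_elem)

lemma dihedral_coset_in_alt_geodesics: "i \<noteq> j \<Longrightarrow> dihedral_coset g i j \<in> alt_geodesics"
  by (auto simp: alt_geodesics_eq)

lemma distinct_adj_ray:
  assumes "\<And>m. s m \<noteq> s (Suc m)"
  shows "distinct_adj (map s [m..<n])"
  using assms by (auto simp: distinct_adj_conv_nth)

text \<open>A ray meeting the same geodesic infinitely often stays on it.\<close>

lemma ray_small_eventually_alternating:
  fixes s :: "nat \<Rightarrow> 'n::finite"
  assumes fin: "finite {\<gamma> \<in> alt_geodesics. norm (hurwitz_map a \<gamma>) \<le> K}"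
    and adj: "\<And>m. s m \<noteq> s (Suc m)" and ij: "i \<noteq> j"
    and inf: "\<exists>\<^sub>\<infinity>m. norm (pair_prod i j (fold hurwitz_b (map s [0..<m]) a)) \<le> K"
  shows "\<exists>m0. \<forall>m\<ge>m0. s m \<in> {i, j}"
proof -
  define c where "c = (\<lambda>m. dihedral_coset (word_elem (map s [0..<m])) i j)"
  define M where "M = {m. norm (pair_prod i j (fold hurwitz_b (map s [0..<m]) a)) \<le> K}"
  have "infinite M" using inf by (simp add: M_def frequently_cofinite)
  moreover have "c ` M \<subseteq> {\<gamma> \<in> alt_geodesics. norm (hurwitz_map a \<gamma>) \<le> K}"
    using ij by (auto simp: c_def M_def hurwitz_map_word dihedral_coset_in_alt_geodesics)
  then have "finite (c ` M)" using fin by (rule finite_subset)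
  ultimately obtain m0 where m0: "m0 \<in> M" "infinite {m \<in> M. c m = c m0}"
    using pigeonhole_infinite by blast
  have "s m \<in> {i, j}" if m: "m \<ge> m0" for m
  proof -
    obtain m' where m': "m' > m" "c m' = c m0"
      using m0(2) by (auto simp: infinite_nat_iff_unbounded)
    have "[0..<m'] = [0..<m0] @ [m0..<m']"
      using upt_add_eq_append[of 0 m0 "m' - m0"] m m'(1) by simp
    then have "word_elem (map s [0..<m']) =
        hurwitz_mult (word_elem (map s [0..<m0])) (word_elem (map s [m0..<m']))"
      by (simp flip: word_elem_append)
    then have "dihedral_coset (word_elem (map s [0..<m0])) i j =
        dihedral_coset (hurwitz_mult (word_elem (map s [0..<m0])) (word_elem (map s [m0..<m']))) i j"
      using m'(2) by (simp add: c_def)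
    then have "set (map s [m0..<m']) \<subseteq> {i, j}"
      by (rule dihedral_coset_eqD) (rule distinct_adj_ray[where s = s, OF adj])
    moreover have "s m \<in> set (map s [m0..<m'])" using m m'(1) by simp
    ultimately show ?thesis by blast
  qed
  then show ?thesis by blast
qed

text \<open>Condition (ii) enters through \<open>small\<close>: a pair giving small values
  infinitely often traps the ray. A ray trapped by a pair is alternating; on any other, each of the
  finitely many pairs eventually has values above \<open>K\<close>.\<close>

lemma ray_good_edge:
  fixes a :: "complex ^ 'n::finite"
  assumes n: "CARD('n) \<ge> 3" and a: "a \<in> hurwitz_domain" and R: "R \<ge> 2"
    and adj: "\<And>m. s m \<noteq> s (Suc m)"
  shows "\<exists>m. good_edge R (s m) (fold hurwitz_b (map s [0..<m]) a)"
proof -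
  obtain K where K: "K > 2" and fin: "finite {\<gamma> \<in> alt_geodesics. norm (hurwitz_map a \<gamma>) \<le> K}"
    using a by (auto simp: hurwitz_domain_def)
  define x where "x = (\<lambda>m. fold hurwitz_b (map s [0..<m]) a)"
  have step: "x (Suc m) = hurwitz_b (s m) (x m)" for m by (simp add: x_def)
  have small: "\<exists>m0. \<forall>m\<ge>m0. s m \<in> {i, j}" if "i \<noteq> j" "\<exists>\<^sub>\<infinity>m. norm (pair_prod i j (x m)) \<le> K" for i j
    using that(2) unfolding x_def by (rule ray_small_eventually_alternating[where s = s, OF fin adj that(1)])
  have nonreal: "pair_prod i j (x m) \<notin> complex_of_real ` {-2..2}" if ij: "i \<noteq> j" for i j m
    using a dihedral_coset_in_alt_geodesics[OF ij, of "word_elem (map s [0..<m])"]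
    unfolding hurwitz_domain_def x_def hurwitz_map_word[OF ij, symmetric] by blast
  have "\<exists>m. good_edge R (s m) (x m)"
  proof (cases "\<exists>i j m0. i \<noteq> j \<and> (\<forall>m\<ge>m0. s m \<in> {i, j})")
    case True
    then obtain i j m0 where "\<And>m. m \<ge> m0 \<Longrightarrow> s m \<in> {i, j}" by blast
    then show ?thesis
      using ray_good_edge_alternating[OF n K R step adj nonreal small] by blast
  next
    case False
    then have nonalt: "\<exists>\<^sub>\<infinity>m. s m \<notin> {i, j}" if "i \<noteq> j" for i j
      using that unfolding INFM_nat_le by blast
    have "\<not> (\<exists>\<^sub>\<infinity>m. norm (pair_prod i j (x m)) \<le> K)" if "i \<noteq> j" for i j
      using small[OF that] False that by blast
    then have "\<forall>\<^sub>F m in sequentially. i \<noteq> j \<longrightarrow> norm (pair_prod i j (x m)) > K" for i j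
      by (cases "i = j") (auto simp: not_frequently not_le cofinite_eq_sequentially)
    then have "\<forall>\<^sub>F m in sequentially. \<forall>i j. i \<noteq> j \<longrightarrow> norm (pair_prod i j (x m)) > K"
      by (intro eventually_all_finite)
    then obtain m0 where big: "\<And>m i j. m \<ge> m0 \<Longrightarrow> i \<noteq> j \<Longrightarrow> norm (pair_prod i j (x m)) > K"
      by (auto simp: eventually_sequentially)
    show ?thesis by (rule ray_good_edge_nonalternating[OF n K step adj big nonalt])
  qed
  then show ?thesis by (simp add: x_def)
qed

text \<open>The reduced words crossing no good edge form a tree, which has bounded depth by
  \<open>koenig_words\<close> and \<open>ray_good_edge\<close>. A word of length \<open>N\<close>
  has therefore crossed a good edge, and \<open>good_edge_extend\<close> passes goodness on to the
  next edge.\<close>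

lemma uniform_good_depth:
  fixes a :: "complex ^ 'n::finite"
  assumes n: "CARD('n) \<ge> 3" and a: "a \<in> hurwitz_domain" and R: "R \<ge> 2"
  obtains N where "\<And>u i. distinct_adj (u @ [i]) \<Longrightarrow> length u = N \<Longrightarrow> good_edge R i (fold hurwitz_b u a)"
proof -
  define P where "P = (\<lambda>w. distinct_adj w \<and>
    (\<forall>k<length w. \<not> good_edge R (w ! k) (fold hurwitz_b (take k w) a)))"
  have prefix: "P u" if "P (u @ v)" for u v
    unfolding P_def
  proof (intro conjI allI impI)
    show "distinct_adj u" using that by (auto simp: P_def)
    fix k assume k: "k < length u"
    then have "\<not> good_edge R ((u @ v) ! k) (fold hurwitz_b (take k (u @ v)) a)"
      using that by (simp add: P_def del: take_append)
    then show "\<not> good_edge R (u ! k) (fold hurwitz_b (take k u) a)"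
      using k by (simp add: nth_append)
  qed
  have "\<exists>N. \<forall>w. length w = N \<longrightarrow> \<not> P w"
  proof (rule ccontr)
    assume "\<not> ?thesis"
    then have "\<exists>w. length w = N \<and> P w" for N by blast
    then obtain s where s: "\<And>N. P (map s [0..<N])" using koenig_words[of P] prefix by blast
    have "s m \<noteq> s (Suc m)" for m
    proof -
      have "distinct_adj (map s [0..<Suc (Suc m)])" using s unfolding P_def by blast
      from distinct_adj_nth[OF this, of m] show ?thesis by (simp del: upt_Suc)
    qed
    then obtain m where "good_edge R (s m) (fold hurwitz_b (map s [0..<m]) a)"
      using ray_good_edge[OF n a R] by blast
    moreover have "\<not> good_edge R (map s [0..<Suc m] ! m) (fold hurwitz_b (take m (map s [0..<Suc m])) a)"
      using s[of "Suc m"] unfolding P_def by (simp del: upt_Suc)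
    moreover have "map s [0..<Suc m] ! m = s m" "take m (map s [0..<Suc m]) = map s [0..<m]"
      by (simp_all add: take_map nth_append)
    ultimately show False by (simp only: not_True_eq_False)
  qed
  then obtain N where N: "\<And>w. length w = N \<Longrightarrow> \<not> P w" by blast
  have "good_edge R i (fold hurwitz_b u a)" if u: "distinct_adj (u @ [i])" "length u = N" for u i
  proof -
    have "distinct_adj u" using u(1) by (rule distinct_adj_appendD1)
    then obtain k where k: "k < N" "good_edge R (u ! k) (fold hurwitz_b (take k u) a)"
      using N[OF u(2)] u(2) unfolding P_def by blast
    have eq: "take k u @ [u ! k] @ drop (Suc k) u = u" using k(1) u(2) by (simp add: id_take_nth_drop[symmetric])
    then have "distinct_adj (take k u @ [u ! k] @ drop (Suc k) u @ [i])" using u(1) by (metis append_assoc)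
    from good_edge_extend[OF R this k(2)] show ?thesis by (simp only: eq)
  qed
  then show ?thesis by (rule that)
qed

section \<open>Local uniform finiteness of the small geodesics\<close>

lemma finite_words: "finite {u :: 'n::finite list. length u \<le> N}"
  using finite_lists_length_le[of "UNIV :: 'n set" N] by simp

text \<open>If the vertex given by \<open>dihedral_coset_gate\<close> lies deeper than
  \<open>N\<close>, the edge leading to it is good and its label avoids \<open>i\<close> and
  \<open>j\<close>, so the second clause of \<open>good_edge\<close> makes the value on \<gamma>
  exceed \<open>R\<close>.\<close>

lemma good_depth_large:
  assumes R: "R \<ge> 2"
    and good: "\<And>u i. distinct_adj (u @ [i]) \<Longrightarrow> length u = N \<Longrightarrow> good_edge R i (fold hurwitz_b u a)"
    and \<gamma>: "\<gamma> \<in> alt_geodesics" "norm (hurwitz_map a \<gamma>) \<le> R"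
  shows "\<exists>u i j. length u \<le> N \<and> i \<noteq> j \<and> \<gamma> = dihedral_coset (word_elem u) i j"
proof -
  obtain g i j where g: "i \<noteq> j" "\<gamma> = dihedral_coset g i j" using \<gamma>(1) by (auto simp: alt_geodesics_eq)
  obtain u where u: "distinct_adj u" "\<gamma> = dihedral_coset (word_elem u) i j" "u = [] \<or> last u \<notin> {i, j}"
    unfolding g(2) by (rule dihedral_coset_gate)
  have "length u \<le> N"
  proof (rule ccontr)
    assume "\<not> ?thesis"
    then obtain v l where v: "u = v @ [l]" "length v \<ge> N" by (cases u rule: rev_cases) auto
    have "good_edge R l (fold hurwitz_b v a)"
    proof (cases "length v = N")
      case True
      then show ?thesis using good u(1) v(1) by blast
    next
      case False
      then have len: "N < length v" using v(2) by simp
      have split: "take N v @ [v ! N] @ drop (Suc N) v = v"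
        using len by (simp add: id_take_nth_drop[symmetric])
      then have d: "distinct_adj (take N v @ [v ! N] @ drop (Suc N) v @ [l])"
        using u(1) v(1) by (metis append_assoc)
      then have "distinct_adj ((take N v @ [v ! N]) @ drop (Suc N) v @ [l])" by simp
      then have "distinct_adj (take N v @ [v ! N])" by (rule distinct_adj_appendD1)
      then have "good_edge R (v ! N) (fold hurwitz_b (take N v) a)" using good len by simp
      from good_edge_extend[OF R d this] show ?thesis by (simp only: split)
    qed
    then have "norm (pair_prod i j (fold hurwitz_b u a)) > R"
      using u(3) g(1) v(1) unfolding good_edge_def by auto
    then show False using \<gamma>(2) unfolding u(2) hurwitz_map_word[OF g(1)] by simp
  qed
  then show ?thesis using u(2) g(1) by blast
qed

text \<open>Only finitely many edges start at depth \<open>N\<close>, and each is good on an open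
  set of base points; the finite set \<open>F\<close> depends on \<open>N\<close> alone.\<close>

lemma locally_uniformly_finite:
  fixes a :: "complex ^ 'n::finite"
  assumes n: "CARD('n) \<ge> 3" and a: "a \<in> hurwitz_domain" and R: "R \<ge> 2"
  obtains U F where "open U" "a \<in> U" "finite F" "F \<subseteq> alt_geodesics"
    "\<And>x \<gamma>. x \<in> U \<Longrightarrow> \<gamma> \<in> alt_geodesics \<Longrightarrow> norm (hurwitz_map x \<gamma>) \<le> R \<Longrightarrow> \<gamma> \<in> F"
proof -
  obtain N where N: "\<And>u i. distinct_adj (u @ [i]) \<Longrightarrow> length u = N \<Longrightarrow> good_edge R i (fold hurwitz_b u a)"
    using uniform_good_depth[OF n a R] by blast
  define T where "T = {(u :: 'n list, i). distinct_adj (u @ [i]) \<and> length u = N}"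
  define U where "U = (\<Inter>(u, i)\<in>T. {x. good_edge R i (fold hurwitz_b u x)})"
  define F where "F = (\<lambda>(u, i, j). dihedral_coset (word_elem u) i j) `
    ({u :: 'n list. length u \<le> N} \<times> {(i, j). i \<noteq> j})"
  have "T \<subseteq> {u. length u \<le> N} \<times> UNIV" by (auto simp: T_def)
  then have "finite T" by (rule finite_subset) (intro finite_cartesian_product finite_words finite)
  moreover have "open {x. good_edge R i (fold hurwitz_b u x)}" for u i
  proof -
    have "open ((\<lambda>x. fold hurwitz_b u x) -` {x. good_edge R i x})"
      by (intro open_vimage open_good_edge continuous_intros)
    then show ?thesis by (simp add: vimage_def)
  qed
  ultimately have "open U" unfolding U_def by (intro open_INT) auto
  moreover have "a \<in> U" using N by (auto simp: U_def T_def)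
  moreover have "finite F"
    unfolding F_def by (intro finite_imageI finite_cartesian_product finite_words finite)
  moreover have "F \<subseteq> alt_geodesics"
    by (auto simp: F_def intro: dihedral_coset_in_alt_geodesics)
  moreover have "\<gamma> \<in> F"
    if x: "x \<in> U" and \<gamma>: "\<gamma> \<in> alt_geodesics" "norm (hurwitz_map x \<gamma>) \<le> R" for x \<gamma>
  proof -
    have "good_edge R i (fold hurwitz_b u x)" if "distinct_adj (u @ [i])" "length u = N" for u i
      using x that by (auto simp: U_def T_def)
    from good_depth_large[OF R this \<gamma>] show ?thesis unfolding F_def by force
  qed
  ultimately show ?thesis by (rule that)
qed

section \<open>Openness of the domain\<close>

lemma continuous_on_hurwitz_map:
  assumes "\<gamma> \<in> alt_geodesics"
  shows "continuous_on UNIV (\<lambda>x. hurwitz_map x \<gamma>)"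
proof -
  obtain g i j where g: "i \<noteq> j" "\<gamma> = dihedral_coset g i j" using assms by (auto simp: alt_geodesics_eq)
  obtain w where "g = word_elem w" using hurwitz_elem_cases by blast
  then show ?thesis
    unfolding g(2) by (simp only: hurwitz_map_word[OF g(1)]) (intro continuous_intros)
qed

lemma norm_le_2_if_real_interval: "z \<in> complex_of_real ` {-2..2} \<Longrightarrow> norm z \<le> 2"
  by auto

lemma open_hurwitz_domain:
  assumes n: "CARD('n::finite) \<ge> 3"
  shows "open (hurwitz_domain :: (complex ^ 'n) set)"
proof (subst open_subopen, intro ballI)
  fix a :: "complex ^ 'n" assume a: "a \<in> hurwitz_domain"
  \<comment> \<open>Any bound above 2 would do: it keeps the values outside \<open>F\<close> away
    from the excluded interval, and it serves as the \<open>K\<close> of condition (ii).\<close>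
  obtain U F where UF: "open U" "a \<in> U" "finite F" "F \<subseteq> alt_geodesics"
    "\<And>x \<gamma>. x \<in> U \<Longrightarrow> \<gamma> \<in> alt_geodesics \<Longrightarrow> norm (hurwitz_map x \<gamma>) \<le> 3 \<Longrightarrow> \<gamma> \<in> F"
    using locally_uniformly_finite[OF n a, of 3] by auto
  define V where "V = U \<inter> (\<Inter>\<gamma>\<in>F. {x. hurwitz_map x \<gamma> \<notin> complex_of_real ` {-2..2}})"
  have "closed (complex_of_real ` {-2..2})"
    by (intro compact_imp_closed compact_continuous_image continuous_intros compact_Icc)
  then have "open ((\<lambda>x. hurwitz_map x \<gamma>) -` (- complex_of_real ` {-2..2}))" if "\<gamma> \<in> F" for \<gamma>
    using that UF(4) by (intro open_vimage continuous_on_hurwitz_map) auto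
  then have "open V"
    unfolding V_def using UF(1,3) by (intro open_Int open_INT) (auto simp: vimage_def Compl_eq)
  moreover have "a \<in> V" using UF(2,4) a by (auto simp: V_def hurwitz_domain_def)
  moreover have "V \<subseteq> hurwitz_domain"
  proof
    fix x assume x: "x \<in> V"
    have "{\<gamma> \<in> alt_geodesics. norm (hurwitz_map x \<gamma>) \<le> 3} \<subseteq> F"
      using UF(5) x by (auto simp: V_def)
    then have "finite {\<gamma> \<in> alt_geodesics. norm (hurwitz_map x \<gamma>) \<le> 3}"
      using UF(3) by (rule finite_subset)
    moreover have "hurwitz_map x \<gamma> \<notin> complex_of_real ` {-2..2}" if "\<gamma> \<in> alt_geodesics" for \<gamma>
    proof (cases "\<gamma> \<in> F")
      case True
      then show ?thesis using x by (auto simp: V_def)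
    next
      case False
      then have "norm (hurwitz_map x \<gamma>) > 3" using UF(5)[of x \<gamma>] x that by (force simp: V_def)
      then show ?thesis using norm_le_2_if_real_interval[of "hurwitz_map x \<gamma>"] by linarith
    qed
    ultimately show "x \<in> hurwitz_domain"
      unfolding hurwitz_domain_def by (auto intro!: exI[of _ 3])
  qed
  ultimately show "\<exists>T. open T \<and> a \<in> T \<and> T \<subseteq> hurwitz_domain" by blast
qed

section \<open>Invariance and proper discontinuity\<close>

lemma hurwitz_map_act:
  assumes "\<gamma> \<in> alt_geodesics"
  shows "hurwitz_map (hurwitz_act h a) \<gamma> =
      hurwitz_map a (hurwitz_mult (inv\<^bsub>hurwitz_group\<^esub> h) ` \<gamma>)"
    and "hurwitz_mult h ` \<gamma> \<in> alt_geodesics"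
proof -
  obtain g i j where g: "i \<noteq> j" "\<gamma> = dihedral_coset g i j" using assms by (auto simp: alt_geodesics_eq)
  show "hurwitz_map (hurwitz_act h a) \<gamma> =
      hurwitz_map a (hurwitz_mult (inv\<^bsub>hurwitz_group\<^esub> h) ` \<gamma>)"
    unfolding g(2) dihedral_coset_left_mult by (simp add: hurwitz_map_pair_prod[OF g(1)] hurwitz_Phi_act)
  show "hurwitz_mult h ` \<gamma> \<in> alt_geodesics"
    unfolding g(2) dihedral_coset_left_mult by (rule dihedral_coset_in_alt_geodesics[OF g(1)])
qed

lemma hurwitz_act_domain:
  assumes a: "a \<in> hurwitz_domain"
  shows "hurwitz_act h a \<in> hurwitz_domain"
proof -
  let ?t = "\<lambda>\<gamma>. hurwitz_mult (inv\<^bsub>hurwitz_group\<^esub> h) ` \<gamma>"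
  obtain K where K: "K > 2" "finite {\<gamma> \<in> alt_geodesics. norm (hurwitz_map a \<gamma>) \<le> K}"
    using a by (auto simp: hurwitz_domain_def)
  have inj: "inj (hurwitz_mult (inv\<^bsub>hurwitz_group\<^esub> h))"
    by (simp add: inj_def hurwitz_mult_left_cancel)
  have "?t ` {\<gamma> \<in> alt_geodesics. norm (hurwitz_map (hurwitz_act h a) \<gamma>) \<le> K} \<subseteq>
      {\<gamma> \<in> alt_geodesics. norm (hurwitz_map a \<gamma>) \<le> K}"
    by (auto simp: hurwitz_map_act)
  then have "finite (?t ` {\<gamma> \<in> alt_geodesics. norm (hurwitz_map (hurwitz_act h a) \<gamma>) \<le> K})"
    using K(2) by (rule finite_subset)
  then have "finite {\<gamma> \<in> alt_geodesics. norm (hurwitz_map (hurwitz_act h a) \<gamma>) \<le> K}"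
    by (rule finite_imageD) (auto intro!: inj_onI simp: inj_image_eq_iff[OF inj])
  moreover have "hurwitz_map (hurwitz_act h a) \<gamma> \<notin> complex_of_real ` {-2..2}" if "\<gamma> \<in> alt_geodesics" for \<gamma>
    using a that unfolding hurwitz_map_act(1)[OF that] hurwitz_domain_def
    by (blast intro: hurwitz_map_act(2))
  ultimately show ?thesis unfolding hurwitz_domain_def using K(1) by blast
qed

lemma hurwitz_act_image_domain: "hurwitz_act h ` hurwitz_domain = hurwitz_domain"
proof
  show "hurwitz_act h ` hurwitz_domain \<subseteq> hurwitz_domain" using hurwitz_act_domain by blast
  show "hurwitz_domain \<subseteq> hurwitz_act h ` hurwitz_domain"
  proof
    fix a :: "complex ^ 'a" assume a: "a \<in> hurwitz_domain"
    have "hurwitz_act h (hurwitz_act (inv\<^bsub>hurwitz_group\<^esub> h) a) = a"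
      using group.r_inv[OF group_hurwitz_group, of h]
      by (metis UNIV_I carrier_hurwitz_group comp_apply hurwitz_act_mult hurwitz_act_one id_apply
          mult_hurwitz_group one_hurwitz_group)
    then show "a \<in> hurwitz_act h ` hurwitz_domain"
      using hurwitz_act_domain[OF a] by (metis imageI)
  qed
qed

text \<open>If \<open>g\<close> maps a point \<open>x\<close> of the compact set back into it, the
  point of the orbit of \<open>x\<close> over the vertex inverse to \<open>g\<close> is the image of
  \<open>x\<close>. So every geodesic through that vertex has a bounded value at \<open>x\<close>
  and lies in a finite set found by compactness; \<open>finite_vertices_of_cosets\<close> then
  bounds the vertices.\<close>

lemma properly_discontinuous_hurwitz_domain:
  assumes n: "CARD('n::finite) \<ge> 3"
  shows "properly_discontinuous_on hurwitz_group hurwitz_act (hurwitz_domain :: (complex ^ 'n) set)"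
  unfolding properly_discontinuous_on_def
proof (intro allI impI)
  fix C :: "(complex ^ 'n) set" assume C: "compact C \<and> C \<subseteq> hurwitz_domain"
  have "compact ((\<lambda>x. pair_prod i j x) ` C)" for i j
    using C by (intro compact_continuous_image continuous_intros) auto
  then have "bounded ((\<lambda>x. pair_prod i j x) ` C)" for i j by (intro compact_imp_bounded)
  then have "\<exists>B. \<forall>x\<in>C. norm (pair_prod i j x) \<le> B" for i j
    unfolding bounded_iff by (simp add: Ball_image_comp)
  then obtain B where B: "\<And>i j x. x \<in> C \<Longrightarrow> norm (pair_prod i j x) \<le> B i j" by metis
  define R where "R = Max (insert 2 (range (case_prod B)))"
  have R2: "R \<ge> 2" unfolding R_def by (rule Max_ge) auto
  have R: "norm (pair_prod i j x) \<le> R" if "x \<in> C" for i j x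
  proof -
    have "case_prod B (i, j) \<le> R" unfolding R_def by (rule Max_ge) auto
    then show ?thesis using B[OF that, of i j] by simp
  qed
  have "\<exists>U F. open U \<and> a \<in> U \<and> finite F \<and>
      (\<forall>x\<in>U. \<forall>\<gamma>\<in>alt_geodesics. norm (hurwitz_map x \<gamma>) \<le> R \<longrightarrow> \<gamma> \<in> F)" if "a \<in> C" for a
    using locally_uniformly_finite[OF n _ R2, of a] C that by (metis subsetD)
  then obtain U F where UF: "\<And>a. a \<in> C \<Longrightarrow> open (U a) \<and> a \<in> U a \<and> finite (F a) \<and>
      (\<forall>x\<in>U a. \<forall>\<gamma>\<in>alt_geodesics. norm (hurwitz_map x \<gamma>) \<le> R \<longrightarrow> \<gamma> \<in> F a)"
    by metis
  obtain C' where C': "C' \<subseteq> C" "finite C'" "C \<subseteq> (\<Union>a\<in>C'. U a)"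
    using compactE_image[of C C U] C UF by blast
  define S where "S = {g. hurwitz_act g ` C \<inter> C \<noteq> {}}"
  have inv_inv: "inv\<^bsub>hurwitz_group\<^esub> (inv\<^bsub>hurwitz_group\<^esub> g) = g" for g :: "'n hurwitz_elem"
    using group.inv_inv[OF group_hurwitz_group, of g] by simp
  have "finite (m_inv hurwitz_group ` S)"
  proof (rule finite_vertices_of_cosets[OF n])
    show "finite (\<Union>a\<in>C'. F a)" using C' UF by blast
  next
    fix h and i j :: 'n assume h: "h \<in> m_inv hurwitz_group ` S" and ij: "i \<noteq> j"
    then obtain g x where g: "h = inv\<^bsub>hurwitz_group\<^esub> g" "x \<in> C" "hurwitz_act g x \<in> C"
      by (auto simp: S_def)
    have "hurwitz_Phi x h = hurwitz_act g x" by (simp add: hurwitz_Phi_def g(1) inv_inv)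
    then have "norm (hurwitz_map x (dihedral_coset h i j)) \<le> R"
      using R[OF g(3)] by (simp add: hurwitz_map_pair_prod[OF ij])
    moreover obtain a where "a \<in> C'" "x \<in> U a" using C'(3) g(2) by blast
    ultimately show "dihedral_coset h i j \<in> (\<Union>a\<in>C'. F a)"
      using UF[of a] C'(1) dihedral_coset_in_alt_geodesics[OF ij, of h] by blast
  qed
  then have "finite S" by (rule finite_imageD) (metis inj_onI inv_inv)
  then show "finite {g \<in> carrier hurwitz_group. hurwitz_act g ` C \<inter> C \<noteq> {}}"
    by (simp add: S_def)
qed

text \<open>At the point with all coordinates 3 every edge leaving the base vertex is good, so depth
  0 works in \<open>good_depth_large\<close>. For n = 3 the values at the base vertex equal 3, hence
  a threshold strictly between 2 and 3.\<close>

lemma hurwitz_domain_nonempty: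
  assumes n: "CARD('n::finite) \<ge> 3"
  shows "(hurwitz_domain :: (complex ^ 'n) set) \<noteq> {}"
proof -
  define a :: "complex ^ 'n" where "a = (\<chi> i. 3)"
  have pp: "norm (pair_prod i j a) \<ge> 3" if "i \<noteq> j" for i j
  proof -
    have "card (UNIV - {i, j}) = CARD('n) - 2" using that by (simp add: card_Diff_subset)
    then have "pair_prod i j a = 3 ^ (CARD('n) - 2)" by (simp add: pair_prod_def a_def)
    moreover have "(3::real) ^ 1 \<le> 3 ^ (CARD('n) - 2)" using n by (intro power_increasing) auto
    ultimately show ?thesis by (simp add: norm_power)
  qed
  have bi: "norm (hurwitz_b i a $ i) > norm (a $ i)" for i
  proof -
    obtain j where j: "j \<noteq> i" using third_index[OF n] by blast
    have "hurwitz_b i a $ i + a $ i = pair_prod i j a * 3"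
      using hurwitz_b_self[of i j a] j by (simp add: a_def)
    then have "norm (pair_prod i j a) * 3 \<le> norm (hurwitz_b i a $ i) + norm (a $ i)"
      by (metis norm_mult norm_numeral norm_triangle_ineq)
    then show ?thesis using pp[of i j] j by (simp add: a_def)
  qed
  have good: "good_edge (5 / 2) i a" for i
    unfolding good_edge_def
  proof (intro conjI allI impI)
    fix j assume "j \<noteq> i"
    then have "norm (pair_prod i j a) > 2" using pp[of i j] by simp
    then show "norm (pair_prod i j a) > 2 \<and> norm (hurwitz_b i a $ i) > norm (a $ i) \<or>
        escaping (pair_prod i j a) (hurwitz_b i a $ i) (a $ j)"
      using bi by blast
  next
    fix j k assume "j \<noteq> i" "k \<noteq> i" "j \<noteq> k"
    then show "norm (pair_prod j k (hurwitz_b i a)) > 5 / 2"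
      using norm_pair_prod_mono[of i j k 1 a] pp[of j k] bi[of i] by simp
  next
    have "\<forall>j. j \<noteq> i \<longrightarrow> j \<noteq> i \<longrightarrow> norm (pair_prod i j a) > 5 / 2"
      using pp[of i] by fastforce
    then show "\<exists>l. \<forall>j. j \<noteq> i \<longrightarrow> j \<noteq> l \<longrightarrow> norm (pair_prod i j a) > 5 / 2" by blast
  qed
  have large: "norm (hurwitz_map a \<gamma>) > 5 / 2" if \<gamma>: "\<gamma> \<in> alt_geodesics" for \<gamma>
  proof (rule ccontr)
    assume "\<not> ?thesis"
    then have le: "norm (hurwitz_map a \<gamma>) \<le> 5 / 2" by simp
    have "\<exists>u i j. length u \<le> 0 \<and> i \<noteq> j \<and> \<gamma> = dihedral_coset (word_elem u) i j"
      by (rule good_depth_large[OF _ _ \<gamma> le]) (use good in auto)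
    then obtain i j where "i \<noteq> j" "\<gamma> = dihedral_coset (word_elem []) i j" by auto
    then show False using le pp[of i j] by (simp add: hurwitz_map_word)
  qed
  have "{\<gamma> \<in> alt_geodesics. norm (hurwitz_map a \<gamma>) \<le> 5 / 2} = {}" using large by force
  then have "\<exists>K>2. finite {\<gamma> \<in> alt_geodesics. norm (hurwitz_map a \<gamma>) \<le> K}"
    by (intro exI[of _ "5 / 2"]) (simp only: finite.emptyI, simp)
  moreover have "hurwitz_map a \<gamma> \<notin> complex_of_real ` {-2..2}" if "\<gamma> \<in> alt_geodesics" for \<gamma>
    using large[OF that] norm_le_2_if_real_interval[of "hurwitz_map a \<gamma>"] by linarith
  ultimately have "a \<in> hurwitz_domain" by (simp add: hurwitz_domain_def)
  then show ?thesis by blast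
qed

text \<open>At a vertex whose coordinates have norm at most 1, all values of \<phi> are at most 1,
  so only the finitely many geodesics of condition (ii) pass through it.\<close>

lemma finite_bounded_orbit_words:
  fixes a :: "complex ^ 'n::finite"
  assumes n: "CARD('n) \<ge> 3" and a: "a \<in> hurwitz_domain"
  shows "finite {w. distinct_adj w \<and> (\<forall>k. norm (fold hurwitz_b w a $ k) \<le> 1)}"
proof -
  let ?W = "{w. distinct_adj w \<and> (\<forall>k. norm (fold hurwitz_b w a $ k) \<le> 1)}"
  obtain K where K: "K > 2" "finite {\<gamma> \<in> alt_geodesics. norm (hurwitz_map a \<gamma>) \<le> K}"
    using a by (auto simp: hurwitz_domain_def)
  have "finite (word_elem ` ?W)"
  proof (rule finite_vertices_of_cosets[OF n K(2)])
    fix g and i j :: 'n assume g: "g \<in> word_elem ` ?W" and ij: "i \<noteq> j"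
    then obtain w where w: "g = word_elem w" "\<And>k. norm (fold hurwitz_b w a $ k) \<le> 1" by auto
    have "norm (pair_prod i j (fold hurwitz_b w a)) \<le> 1"
      unfolding pair_prod_def prod_norm[symmetric] by (rule prod_le_1) (simp add: w(2))
    then show "dihedral_coset g i j \<in> {\<gamma> \<in> alt_geodesics. norm (hurwitz_map a \<gamma>) \<le> K}"
      using K(1) by (simp add: w(1) hurwitz_map_word[OF ij] dihedral_coset_in_alt_geodesics[OF ij])
  qed
  then show ?thesis
    by (rule finite_imageD) (auto intro!: inj_onI simp: word_elem_inj)
qed

section \<open>Iterated commutators near the origin\<close>

definition near_id :: "real \<Rightarrow> real \<Rightarrow> (complex ^ 'n \<Rightarrow> complex ^ 'n) \<Rightarrow> bool" where
  "near_id r e f \<longleftrightarrow> (\<forall>x. (\<forall>k. norm (x $ k) < r) \<longrightarrow> (\<forall>k. norm (f x $ k - x $ k) \<le> e))"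

lemma holomorphic_on_fold_hurwitz_b:
  assumes "\<And>k. (\<lambda>t. f t $ k) holomorphic_on S"
  shows "(\<lambda>t. fold hurwitz_b w (f t) $ k) holomorphic_on S"
  using assms
proof (induction w arbitrary: f)
  case (Cons i w)
  have "(\<lambda>t. hurwitz_b i (f t) $ k) holomorphic_on S" for k
    unfolding hurwitz_b_nth using Cons.prems by (cases "k = i") (auto intro!: holomorphic_intros)
  from Cons.IH[of "\<lambda>t. hurwitz_b i (f t)", OF this] show ?case by simp
qed simp

text \<open>On the complex line through \<open>z\<close> and \<open>z'\<close> the displacement is
  holomorphic, and it is bounded by \<open>e\<close> on a disc of radius \<open>\<tau> / e\<close>.
  The Schwarz lemma bounds its change between the parameters 0 and 1.\<close>

lemma displacement_lipschitz:
  fixes z z' :: "complex ^ 'n::finite"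
  assumes near: "near_id r e (fold hurwitz_b w)" and e: "0 < e" "e < \<tau>"
    and z: "\<And>k. norm (z $ k) \<le> r - \<tau>" and z': "\<And>k. norm (z' $ k - z $ k) \<le> e"
  shows "norm ((fold hurwitz_b w z' $ k - z' $ k) - (fold hurwitz_b w z $ k - z $ k)) \<le> 3 * e * e / \<tau>"
proof -
  define T where "T = \<tau> / e"
  define p where "p = (\<lambda>t::complex. (\<chi> k. z $ k + t * (z' $ k - z $ k)))"
  define h where "h = (\<lambda>t. fold hurwitz_b w (p t) $ k - p t $ k)"
  \<comment> \<open>The change is at most \<open>2 * e\<close>; dividing by \<open>3 * e\<close>
    gives the strict bound by 1 that the Schwarz lemma needs.\<close>
  define f where "f = (\<lambda>s. (h (of_real T * s) - h 0) / (3 * of_real e))"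
  have T: "T > 1" unfolding T_def using e by simp
  have hol_h: "h holomorphic_on UNIV"
    unfolding h_def
    by (intro holomorphic_intros holomorphic_on_fold_hurwitz_b) (auto simp: p_def intro!: holomorphic_intros)
  have hol: "f holomorphic_on ball 0 1"
  proof -
    have "(\<lambda>s. h (of_real T * s)) holomorphic_on ball 0 1"
      using holomorphic_on_compose_gen[of "\<lambda>s. of_real T * s" "ball 0 1" h UNIV] hol_h
      by (auto simp: o_def intro!: holomorphic_intros)
    then show ?thesis unfolding f_def using e(1) by (intro holomorphic_intros) auto
  qed
  have bound: "norm (h (of_real T * s)) \<le> e" if s: "norm s < 1" for s
  proof -
    have "norm (p (of_real T * s) $ l) < r" for l
    proof -
      have "norm (of_real T * s * (z' $ l - z $ l)) \<le> T * norm s * e"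
        unfolding norm_mult using T z'[of l] by (auto intro!: mult_left_mono)
      also have "\<dots> = \<tau> * norm s" using e(1) by (simp add: T_def)
      also have "\<dots> < \<tau> * 1" using s e by (intro mult_strict_left_mono) auto
      finally show ?thesis
        unfolding p_def using z[of l] norm_triangle_ineq[of "z $ l" "of_real T * s * (z' $ l - z $ l)"]
        by simp
    qed
    then show ?thesis using near unfolding near_id_def h_def by blast
  qed
  have lt: "norm (f s) < 1" if s: "norm s < 1" for s
  proof -
    have "norm (h (of_real T * s) - h 0) \<le> 2 * e"
      using bound[OF s] bound[of 0] norm_triangle_ineq4[of "h (of_real T * s)" "h 0"] by simp
    then show ?thesis unfolding f_def using e(1) by (simp add: norm_divide norm_mult divide_less_eq)
  qed
  have "norm (f (of_real (1 / T))) \<le> norm (of_real (1 / T) :: complex)"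
    by (rule Schwarz_Lemma(1)[OF hol _ lt]) (use T in \<open>auto simp: f_def norm_divide\<close>)
  also have "norm (of_real (1 / T) :: complex) = e / \<tau>"
    using T e unfolding norm_of_real by (simp add: T_def)
  finally have "norm (f (of_real (1 / T))) \<le> e / \<tau>" .
  moreover have "f (of_real (1 / T)) = (h 1 - h 0) / (3 * of_real e)"
    using T by (simp add: f_def)
  ultimately have "norm (h 1 - h 0) \<le> 3 * e * (e / \<tau>)"
    using e(1) by (simp add: norm_divide norm_mult divide_le_eq mult_ac)
  moreover have "p 1 = z'" "p 0 = z" by (simp_all add: p_def vec_eq_iff)
  ultimately show ?thesis by (simp add: h_def)
qed

lemma fold_hurwitz_b_rev: "fold hurwitz_b (rev w) (fold hurwitz_b w x) = x"
proof (induction w arbitrary: x)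
  case (Cons i w)
  then show ?case by (simp add: hurwitz_b_involution)
qed simp

text \<open>Write the maps of \<open>rev q\<close> and \<open>rev p\<close> as \<open>id + u\<close> and \<open>id + v\<close>. The commutator moves
  \<open>x\<close>, the image of \<open>z\<close> under one order of composition, to the image under the other order, and
  the two differ by \<open>(u (z + v z) - u z) - (v (z + u z) - v z)\<close>.\<close>

lemma near_id_commutator:
  fixes p q :: "'n::finite list"
  assumes p: "near_id r e (fold hurwitz_b p)" "near_id r e (fold hurwitz_b (rev p))"
    and q: "near_id r e (fold hurwitz_b q)" "near_id r e (fold hurwitz_b (rev q))"
    and e: "0 < e" "e < \<tau>" and r': "r' + 2 * e \<le> r - \<tau>"
  shows "near_id r' (6 * e * e / \<tau>) (fold hurwitz_b (p @ q @ rev p @ rev q))"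
  unfolding near_id_def
proof (intro allI impI)
  fix x :: "complex ^ 'n" and k
  assume x: "\<forall>k. norm (x $ k) < r'"
  let ?F = "fold hurwitz_b (rev q)" and ?G = "fold hurwitz_b (rev p)"
  define x1 where "x1 = fold hurwitz_b p x"
  define z where "z = fold hurwitz_b q x1"
  have tri: "norm b \<le> norm a + norm (b - a)" for a b :: complex
    using norm_triangle_ineq[of a "b - a"] by simp
  have x1: "norm (x1 $ l) < r' + e" for l
  proof -
    have "\<forall>k. norm (x $ k) < r" using x e r' by (smt (verit))
    then have "norm (x1 $ l - x $ l) \<le> e" using p(1) by (simp add: near_id_def x1_def)
    then show ?thesis using tri[of "x1 $ l" "x $ l"] x[rule_format, of l] by simp
  qed
  \<comment> \<open>Two displacements by at most \<open>e\<close> use up the term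
    \<open>2 * e\<close> of \<open>r'\<close> and leave the margin required by
    \<open>displacement_lipschitz\<close>.\<close>
  have z: "norm (z $ l) \<le> r - \<tau>" for l
  proof -
    have "\<forall>k. norm (x1 $ k) < r" using x1 e r' by (smt (verit))
    then have "norm (z $ l - x1 $ l) \<le> e" using q(1) by (simp add: near_id_def z_def)
    then show ?thesis using tri[of "z $ l" "x1 $ l"] x1[of l] r' by simp
  qed
  then have zr: "\<forall>k. norm (z $ k) < r" using e by (smt (verit))
  have F: "norm (?F z $ l - z $ l) \<le> e" and G: "norm (?G z $ l - z $ l) \<le> e" for l
    using p(2) q(2) zr unfolding near_id_def by blast+
  have "?F z = x1" by (simp add: z_def fold_hurwitz_b_rev)
  then have xz: "x = ?G (?F z)" by (simp add: x1_def fold_hurwitz_b_rev)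
  have "fold hurwitz_b (p @ q @ rev p @ rev q) x = ?F (?G z)"
    by (simp add: z_def x1_def)
  then have "fold hurwitz_b (p @ q @ rev p @ rev q) x $ k - x $ k =
      ((?F (?G z) $ k - ?G z $ k) - (?F z $ k - z $ k)) - ((?G (?F z) $ k - ?F z $ k) - (?G z $ k - z $ k))"
    by (subst (2) xz) simp
  also have "norm \<dots> \<le> 3 * e * e / \<tau> + 3 * e * e / \<tau>"
    by (intro order_trans[OF norm_triangle_ineq4] add_mono
        displacement_lipschitz[OF q(2) e z G] displacement_lipschitz[OF p(2) e z F])
  finally show "norm (fold hurwitz_b (p @ q @ rev p @ rev q) x $ k - x $ k) \<le> 6 * e * e / \<tau>"
    by simp
qed

text \<open>The product in \<open>hurwitz_b i\<close> has at least two factors, so the linear part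
  at the origin only negates coordinate \<open>i\<close>. Each letter adds an error of at most
  \<open>(2 * r)\<^sup>2\<close>, because \<open>len\<close> keeps all coordinates within
  \<open>2 * r\<close>.\<close>

lemma fold_hurwitz_b_near_reflection:
  fixes x :: "complex ^ 'n::finite"
  assumes n: "CARD('n) \<ge> 3" and x: "\<And>k. norm (x $ k) \<le> r" and r: "0 \<le> r" "r \<le> 1 / 2"
    and len: "real (length w) * (4 * r\<^sup>2) \<le> r"
  shows "norm (fold hurwitz_b w x $ k - (- 1) ^ count_list w k * x $ k) \<le> real (length w) * (4 * r\<^sup>2)"
  using len
proof (induction w arbitrary: k rule: rev_induct)
  case Nil
  show ?case by simp
next
  case (snoc i w)
  have len: "real (length w) * (4 * r\<^sup>2) \<le> r"
  proof -
    have "real (length w) * (4 * r\<^sup>2) \<le> real (length (w @ [i])) * (4 * r\<^sup>2)"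
      by (intro mult_right_mono) auto
    then show ?thesis using snoc.prems by (rule order_trans)
  qed
  define y where "y = fold hurwitz_b w x"
  have IH: "norm (y $ k - (- 1) ^ count_list w k * x $ k) \<le> real (length w) * (4 * r\<^sup>2)" for k
    unfolding y_def by (rule snoc.IH[OF len])
  have y: "norm (y $ k) \<le> 2 * r" for k
  proof -
    have "norm (y $ k) \<le> norm ((- 1) ^ count_list w k * x $ k) + norm (y $ k - (- 1) ^ count_list w k * x $ k)"
      using norm_triangle_ineq[of "(- 1) ^ count_list w k * x $ k" "y $ k - (- 1) ^ count_list w k * x $ k"]
      by simp
    also have "norm ((- 1) ^ count_list w k * x $ k) = norm (x $ k)" by (simp add: norm_mult norm_power)
    finally show ?thesis using IH[of k] x[of k] len by linarith
  qed
  have step: "4 * r\<^sup>2 + real (length w) * (4 * r\<^sup>2) = real (length (w @ [i])) * (4 * r\<^sup>2)"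
    by (simp add: algebra_simps)
  show ?case
  proof (cases "k = i")
    case True
    have "norm (\<Prod>j\<in>UNIV - {i}. y $ j) \<le> (\<Prod>j\<in>UNIV - {i}. 2 * r)"
      unfolding prod_norm[symmetric] by (intro prod_mono) (simp add: y)
    also have "\<dots> = (2 * r) ^ (CARD('n) - 1)" by (simp add: card_Diff_singleton)
    also have "\<dots> \<le> (2 * r)\<^sup>2" using n r by (intro power_decreasing) auto
    finally have P: "norm (\<Prod>j\<in>UNIV - {i}. y $ j) \<le> 4 * r\<^sup>2" by (simp add: power_mult_distrib)
    have "fold hurwitz_b (w @ [i]) x $ k - (- 1) ^ count_list (w @ [i]) k * x $ k =
        (\<Prod>j\<in>UNIV - {i}. y $ j) - (y $ k - (- 1) ^ count_list w k * x $ k)"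
      using True by (simp add: hurwitz_b_nth flip: y_def)
    also have "norm \<dots> \<le> 4 * r\<^sup>2 + real (length w) * (4 * r\<^sup>2)"
      by (intro order_trans[OF norm_triangle_ineq4] add_mono P IH)
    finally show ?thesis by (simp only: step)
  next
    case False
    then have "fold hurwitz_b (w @ [i]) x $ k - (- 1) ^ count_list (w @ [i]) k * x $ k =
        y $ k - (- 1) ^ count_list w k * x $ k"
      by (simp add: hurwitz_b_nth flip: y_def)
    also have "norm \<dots> \<le> 4 * r\<^sup>2 + real (length w) * (4 * r\<^sup>2)"
      using IH[of k] by (simp add: add_increasing)
    finally show ?thesis by (simp only: step)
  qed
qed

text \<open>Even multiplicities cancel all signs. Six letters give an error of at most 24 r^2 \<le>
  24 r / 4096, below r / 128 = 32 r / 4096.\<close>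

lemma near_id_even_word:
  fixes w :: "'n::finite list"
  assumes n: "CARD('n) \<ge> 3" and r: "0 < r" "r \<le> 1 / 4096" and len: "length w \<le> 6"
    and even: "\<And>k. even (count_list w k)"
  shows "near_id r (r / 128) (fold hurwitz_b w)"
  unfolding near_id_def
proof (intro allI impI)
  fix x :: "complex ^ 'n" and k
  assume x: "\<forall>k. norm (x $ k) < r"
  have "real (length w) * (4 * r\<^sup>2) \<le> 6 * (4 * r\<^sup>2)" using len by (intro mult_right_mono) auto
  also have "\<dots> = 24 * (r * r)" by (simp add: power2_eq_square)
  also have "\<dots> \<le> 24 * (r * (1 / 4096))" using r by (intro mult_left_mono) auto
  also have "\<dots> \<le> r / 128" using r by simp
  finally have b: "real (length w) * (4 * r\<^sup>2) \<le> r / 128" .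
  have "norm (fold hurwitz_b w x $ k - (- 1) ^ count_list w k * x $ k) \<le> real (length w) * (4 * r\<^sup>2)"
    by (rule fold_hurwitz_b_near_reflection[OF n]) (use x r b in \<open>auto intro: less_imp_le\<close>)
  then show "norm (fold hurwitz_b w x $ k - x $ k) \<le> r / 128"
    using b even[of k] by simp
qed

text \<open>Fixing the first and the last letter prevents cancellation in the commutators, so that
  they have increasing length; the shrinking radii leave room for the Schwarz lemma.\<close>

lemma near_id_words:
  fixes i j :: "'n::finite"
  assumes n: "CARD('n) \<ge> 3" and r: "0 < r" "r \<le> 1 / 4096"
  shows "\<exists>w. distinct_adj w \<and> w \<noteq> [] \<and> hd w = i \<and> last w = j \<and> length w > N \<and>
    near_id (r / 2 * (1 + (1 / 2) ^ N)) (r * (1 / 2) ^ N / 128) (fold hurwitz_b w) \<and>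
    near_id (r / 2 * (1 + (1 / 2) ^ N)) (r * (1 / 2) ^ N / 128) (fold hurwitz_b (rev w))"
    (is "\<exists>w. ?P N i j w")
proof (induction N arbitrary: i j)
  case 0
  obtain k where k: "k \<noteq> i" "k \<noteq> j" using third_index[OF n] by blast
  obtain l where l: "l \<noteq> i" "l \<noteq> k" using third_index[OF n] by blast
  \<comment> \<open>The square of a product of two generators, conjugated by \<open>i\<close> when
    both ends have to be \<open>i\<close>; every letter occurs an even number of times.\<close>
  define w where "w = (if i = j then [i, k, l, k, l, i] else [i, j, i, j])"
  have "even (count_list w m)" for m by (simp add: w_def)
  moreover have "even (count_list (rev w) m)" for m by (simp add: w_def)
  moreover have "length w \<le> 6" by (simp add: w_def)
  moreover have "distinct_adj w" "w \<noteq> []" "hd w = i" "last w = j" using k l by (auto simp: w_def)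
  ultimately show ?case using near_id_even_word[OF n r] by (intro exI[of _ w]) auto
next
  case (Suc N)
  define t where "t = (1 / 2 :: real) ^ N"
  have t: "t > 0" by (simp add: t_def)
  \<comment> \<open>The three inequalities are exactly the absence of cancellation at the junctions
    of \<open>p @ q @ rev p @ rev q\<close>.\<close>
  have comm: "\<exists>w. ?P (Suc N) i j w"
    if p: "?P N i e p" and q: "?P N j f q" and ef: "e \<noteq> j" "f \<noteq> e" "i \<noteq> f" for e f p q
  proof -
    \<comment> \<open>The radius drops by r t / 4, enough for \<open>?\<tau>\<close> plus
      \<open>2 * ?e\<close>; the commutator bound is 48 r t / 16384, below half of
      \<open>?e\<close>, which is 64 r t / 16384.\<close>
    let ?e = "r * t / 128" and ?\<tau> = "r * t / 8" and ?r = "r / 2 * (1 + t)" and ?r' = "r / 2 * (1 + t / 2)"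
    have near: "near_id ?r ?e (fold hurwitz_b p)" "near_id ?r ?e (fold hurwitz_b (rev p))"
      "near_id ?r ?e (fold hurwitz_b q)" "near_id ?r ?e (fold hurwitz_b (rev q))"
      using p q by (simp_all add: t_def)
    have e: "0 < ?e" "?e < ?\<tau>" and r': "?r' + 2 * ?e \<le> ?r - ?\<tau>"
      using r(1) t by (simp_all add: field_simps)
    have c1: "near_id ?r' (6 * ?e * ?e / ?\<tau>) (fold hurwitz_b (p @ q @ rev p @ rev q))"
      by (rule near_id_commutator[OF near e r'])
    have c2: "near_id ?r' (6 * ?e * ?e / ?\<tau>) (fold hurwitz_b (q @ p @ rev q @ rev p))"
      by (rule near_id_commutator[OF near(3,4,1,2) e r'])
    have "6 * ?e * ?e / ?\<tau> = 48 * (r * t) / 16384" using r(1) t by (simp add: field_simps)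
    also have "\<dots> \<le> r * (t / 2) / 128" using r(1) t by (simp add: field_simps)
    finally have le: "6 * ?e * ?e / ?\<tau> \<le> r * (t / 2) / 128" .
    have mono: "near_id ?r' (r * (t / 2) / 128) g" if "near_id ?r' (6 * ?e * ?e / ?\<tau>) g"
      for g :: "complex ^ 'n \<Rightarrow> complex ^ 'n"
      using that le unfolding near_id_def by (meson order_trans)
    define w where "w = p @ q @ rev p @ rev q"
    have "rev w = q @ p @ rev q @ rev p" by (simp add: w_def)
    then have "near_id ?r' (r * (t / 2) / 128) (fold hurwitz_b w)"
      "near_id ?r' (r * (t / 2) / 128) (fold hurwitz_b (rev w))"
      using mono[OF c1] mono[OF c2] by (simp_all only: w_def)
    moreover have "distinct_adj w"
      using p q ef by (auto simp: w_def distinct_adj_append_iff hd_rev last_rev hd_append)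
    moreover have "length w > Suc N" "hd w = i" "last w = j" "w \<noteq> []"
      using p q by (auto simp: w_def last_append last_rev)
    moreover have "(1 / 2 :: real) ^ Suc N = t / 2" by (simp add: t_def)
    ultimately show ?thesis by metis
  qed
  show ?case
  proof (cases "i = j")
    case False
    obtain k where k: "k \<noteq> i" "k \<noteq> j" using third_index[OF n] by blast
    obtain p where p: "?P N i k p" using Suc.IH by blast
    obtain q where q: "?P N j j q" using Suc.IH by blast
    show ?thesis using comm[OF p q] k False by blast
  next
    case True
    obtain k where k: "k \<noteq> i" "k \<noteq> j" using third_index[OF n] by blast
    obtain l where l: "l \<noteq> i" "l \<noteq> k" using third_index[OF n] by blast
    obtain p where p: "?P N i k p" using Suc.IH by blast
    obtain q where q: "?P N j l q" using Suc.IH by blast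
    show ?thesis using comm[OF p q] k l True by blast
  qed
qed

text \<open>A point of norm below r / 2 lies in all the shrinking polydiscs of
  \<open>near_id_words\<close>, so reduced words of unbounded length keep it bounded, contradicting
  \<open>finite_bounded_orbit_words\<close>.\<close>

lemma zero_notin_closure_hurwitz_domain:
  assumes n: "CARD('n::finite) \<ge> 3"
  shows "(0 :: complex ^ 'n) \<notin> closure hurwitz_domain"
proof
  define r where "r = (1 / 4096 :: real)"
  have r: "0 < r" "r \<le> 1 / 4096" by (simp_all add: r_def)
  assume "(0 :: complex ^ 'n) \<in> closure hurwitz_domain"
  then obtain a :: "complex ^ 'n" where a: "a \<in> hurwitz_domain" "norm a < r / 2"
    unfolding closure_approachable using r(1) by (metis dist_0_norm dist_commute half_gt_zero)
  define W where "W = {w. distinct_adj w \<and> (\<forall>k. norm (fold hurwitz_b w a $ k) \<le> 1)}"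
  have fin: "finite W" unfolding W_def by (rule finite_bounded_orbit_words[OF n a(1)])
  have "\<exists>w\<in>W. length w > N" for N
  proof -
    obtain w :: "'n list" where w: "distinct_adj w" "length w > N"
      "near_id (r / 2 * (1 + (1 / 2) ^ N)) (r * (1 / 2) ^ N / 128) (fold hurwitz_b w)"
      using near_id_words[OF n r] by blast
    have ak: "norm (a $ k) < r / 2" for k
      using a(2) Finite_Cartesian_Product.norm_nth_le[of a k] by (rule le_less_trans[rotated])
    moreover have "r / 2 * 1 \<le> r / 2 * (1 + (1 / 2) ^ N)" using r(1) by (intro mult_left_mono) auto
    ultimately have "\<forall>k. norm (a $ k) < r / 2 * (1 + (1 / 2) ^ N)" by (smt (verit))
    then have d: "norm (fold hurwitz_b w a $ k - a $ k) \<le> r * (1 / 2) ^ N / 128" for k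
      using w(3) unfolding near_id_def by blast
    have "r * (1 / 2) ^ N \<le> r * 1" using r(1) by (intro mult_left_mono) (auto simp: power_le_one)
    then have "norm (fold hurwitz_b w a $ k - a $ k) \<le> r" for k
      using d[of k] r(1) by linarith
    then have "norm (fold hurwitz_b w a $ k) \<le> r / 2 + r" for k
      using ak[of k] norm_triangle_ineq[of "a $ k" "fold hurwitz_b w a $ k - a $ k"]
      by (smt (verit) add_diff_cancel_left' add_diff_eq)
    moreover have "r / 2 + r \<le> 1" using r by simp
    ultimately have "norm (fold hurwitz_b w a $ k) \<le> 1" for k by (meson order_trans)
    then show ?thesis using w(1,2) by (auto simp: W_def)
  qed
  then obtain w where w: "w \<in> W" "length w > Max (length ` W)" by blast
  have "length w \<le> Max (length ` W)" using w(1) fin by (intro Max_ge) auto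
  then show False using w(2) by simp
qed

theorem theorem1p4:
  fixes D :: "(complex ^ 'n::finite) set"
  assumes n: "CARD('n) \<ge> 3"
    and D: "D = {a.
      (\<forall>\<gamma>\<in>alt_geodesics. hurwitz_map a \<gamma> \<notin> complex_of_real ` {-2..2}) \<and>
      (\<exists>K::real. K > 2 \<and> finite {\<gamma> \<in> alt_geodesics. norm (hurwitz_map a \<gamma>) \<le> K})}"
  shows "D \<noteq> {} \<and> open D
    \<and> (\<forall>g \<in> carrier hurwitz_group. hurwitz_act g ` D = D)
    \<and> properly_discontinuous_on hurwitz_group hurwitz_act D
    \<and> 0 \<notin> closure D"
proof -
  have "D = hurwitz_domain" unfolding D hurwitz_domain_def ..
  then show ?thesis
    using hurwitz_domain_nonempty[OF n] open_hurwitz_domain[OF n]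
      properly_discontinuous_hurwitz_domain[OF n] zero_notin_closure_hurwitz_domain[OF n]
    by (simp add: hurwitz_act_image_domain)
qed

end
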